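(* Assume $p=1$, so that one observes $Y=\theta^*+\xi\in\mathbb{R}^{n\times m}$, where $\theta^*\in\mathbb{R}^{n\times m}$ is non-random and the entries $\xi_{ij}$ are independent zero-mean random variables satisfying, for some $\sigma>0$, $\mathbb{E}\exp(\lambda\xi_{ij})\le\exp(\lambda^2\sigma^2/2)$ for all $\lambda\in\mathbb{R}$ and all $(i,j)\in[n]\times[m]$. Let the alphabets $\mathcal{D}_n$ and $\mathcal{D}_m$ be finite, and let $\hat\theta\in\arg\min_{\theta\in\Theta(s_n,s_m)}\|Y-\theta\|_2^2$ be the least squares estimator. Then there exists a constant $C>0$ depending only on the cardinalities of $\mathcal{D}_n$ and $\mathcal{D}_m$ such that, for all $\theta^*\in\mathbb{R}^{n\times m}$ and all $\epsilon>0$, $$\mathbb{E}_{\theta^*}\left\{\|\hat\theta-\theta^*\|_2^2\right\}\le(1+\epsilon)\inf_{\bar\theta\in\Theta(s_n,s_m)}\|\bar\theta-\theta^*\|_2^2+\frac{C\sigma^2}{\epsilon}\,(R_X+R_B+R_Z).$$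
   Context: Here $[i]=\{1,\dots,i\}$, $\|\cdot\|_2$ is the Frobenius norm, $\|x\|_0$ is the number of non-zero components of a vector $x$, and $a\wedge b=\min(a,b)$. $\mathbb{E}_{\theta^*}$ is the expectation under the distribution of $Y$. Let $n,m,k_n,k_m\ge1$ and $s_n,s_m$ be integers with $0\le s_n\le k_n$, $0\le s_m\le k_m$. Let $\mathcal{D}_n,\mathcal{D}_m\subset\mathbb{R}$ (alphabets). For $1\le s_n\le k_n$, $$\mathcal{A}_{s_n}=\{A\in\mathcal{D}_n^{n\times k_n}:\ \|A_{i\cdot}\|_0\le s_n\text{ for all }i\in[n]\},$$ where $A_{i\cdot}$ is the $i$th row; for $s_n=0$ it is assumed that $n=k_n$ and $\mathcal{A}_{s_n}$ contains only the $n\times n$ identity matrix. $\mathcal{A}_{s_m}$ is defined analogously with $n$ replaced by $m$. The structured class is $$\Theta(s_n,s_m)=\{\theta=XBZ^T:\ X\in\mathcal{A}_{s_n},\ B\in\mathbb{R}^{k_n\times k_m},\ Z\in\mathcal{A}_{s_m}\}\subset\mathbb{R}^{n\times m}.$$ Set $r_n=n\wedge k_n$, $r_m=m\wedge k_m$, and $$R_X=nr_m\wedge ns_n\log\frac{ek_n}{s_n},\qquad R_B=r_nr_m,\qquad R_Z=mr_n\wedge ms_m\log\frac{ek_m}{s_m},$$ with the convention $0\log\frac{x}{0}=0$ for $x>0$.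
   Formalization: The remainder has min(ε,1) in place of ε in the denominator: as stated the claim fails for large ε (1×1 case, Θ=ℝ, Rademacher noise). C is stated for each fixed sample-space type; uniformity over probability spaces follows by passing to the joint law of noise and estimator. *)

theory Defs
  imports "HOL-Probability.Probability" "Jordan_Normal_Form.Matrix"
begin

text \<open>
  Matrices are those of \<^theory>\<open>Jordan_Normal_Form.Matrix\<close>, because the constant of the theorem has
  to be uniform in all dimensions. Indices run from \<open>0\<close> to \<open>n - 1\<close>.
\<close>

definition frobenius_norm :: "real mat \<Rightarrow> real" where
  "frobenius_norm A = sqrt (\<Sum>i<dim_row A. \<Sum>j<dim_col A. (A $$ (i, j))\<^sup>2)"

definition l0_norm :: "real Matrix.vec \<Rightarrow> nat" where
  "l0_norm x = card {j. j < dim_vec x \<and> vec_index x j \<noteq> 0}"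

text \<open>
  For \<open>s = 0\<close> the class is only meant to be used with \<open>n = k\<close>; its one element, the identity matrix,
  need not have its entries in the alphabet.
\<close>

definition factor_class :: "real set \<Rightarrow> nat \<Rightarrow> nat \<Rightarrow> nat \<Rightarrow> real mat set" where
  "factor_class D n k s =
     (if s = 0 then {1\<^sub>m n}
      else {A \<in> carrier_mat n k.
              elements_mat A \<subseteq> D \<and> (\<forall>i<n. l0_norm (Matrix.row A i) \<le> s)})"

definition structured_class ::
  "real set \<Rightarrow> real set \<Rightarrow> nat \<Rightarrow> nat \<Rightarrow> nat \<Rightarrow> nat \<Rightarrow> nat \<Rightarrow> nat \<Rightarrow> real mat set" where
  "structured_class Dn Dm n m kn km sn sm =
     {X * B * transpose_mat Z | X B Z.
        X \<in> factor_class Dn n kn sn \<and> B \<in> carrier_mat kn km \<and> Z \<in> factor_class Dm m km sm}"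

text \<open>
  At \<open>s = 0\<close> the factor \<open>real s\<close> makes the second argument of \<^const>\<open>min\<close> vanish, which is
  the convention \<open>0 * log (x / 0) = 0\<close>.
\<close>

definition rate_X :: "nat \<Rightarrow> nat \<Rightarrow> nat \<Rightarrow> nat \<Rightarrow> nat \<Rightarrow> real" where
  "rate_X n m kn km sn =
     min (real n * real (min m km))
         (real n * real sn * ln (exp 1 * real kn / real sn))"

definition rate_B :: "nat \<Rightarrow> nat \<Rightarrow> nat \<Rightarrow> nat \<Rightarrow> real" where
  "rate_B n m kn km = real (min n kn) * real (min m km)"

definition rate_Z :: "nat \<Rightarrow> nat \<Rightarrow> nat \<Rightarrow> nat \<Rightarrow> nat \<Rightarrow> real" where
  "rate_Z n m kn km sm =
     min (real m * real (min n kn))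
         (real m * real sm * ln (exp 1 * real km / real sm))"

text \<open>
  Integrability of the exponentials is required separately, because the Bochner integral of a
  non-integrable function is \<open>0\<close> and would satisfy the bound vacuously.
\<close>

definition sub_gaussian :: "'a measure \<Rightarrow> real \<Rightarrow> ('a \<Rightarrow> real) \<Rightarrow> bool" where
  "sub_gaussian M \<sigma> X \<longleftrightarrow>
     (\<forall>l. integrable M (\<lambda>\<omega>. exp (l * X \<omega>)) \<and>
          integral\<^sup>L M (\<lambda>\<omega>. exp (l * X \<omega>)) \<le> exp (l\<^sup>2 * \<sigma>\<^sup>2 / 2))"

definition noise_matrix :: "'a measure \<Rightarrow> real \<Rightarrow> nat \<Rightarrow> nat \<Rightarrow> ('a \<Rightarrow> real mat) \<Rightarrow> bool" where
  "noise_matrix M \<sigma> n m \<xi> \<longleftrightarrow>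
     prob_space M \<and>
     (\<forall>\<omega>\<in>space M. \<xi> \<omega> \<in> carrier_mat n m) \<and>
     prob_space.indep_vars M (\<lambda>_. borel) (\<lambda>ij \<omega>. \<xi> \<omega> $$ ij) ({..<n} \<times> {..<m}) \<and>
     (\<forall>ij\<in>{..<n} \<times> {..<m}.
        integrable M (\<lambda>\<omega>. \<xi> \<omega> $$ ij) \<and> integral\<^sup>L M (\<lambda>\<omega>. \<xi> \<omega> $$ ij) = 0 \<and>
        sub_gaussian M \<sigma> (\<lambda>\<omega>. \<xi> \<omega> $$ ij))"

text \<open>
  The estimator is an arbitrary measurable selection of a minimizer. It may depend on \<open>\<omega>\<close>
  beyond the observation \<open>Y \<omega>\<close>, so randomized tie-breaking is included.
\<close>

definition least_squares_estimator ::
  "'a measure \<Rightarrow> nat \<Rightarrow> nat \<Rightarrow> real mat set \<Rightarrow> ('a \<Rightarrow> real mat) \<Rightarrow> ('a \<Rightarrow> real mat) \<Rightarrow> bool" where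
  "least_squares_estimator M n m \<Theta> Y \<theta>h \<longleftrightarrow>
     (\<forall>i<n. \<forall>j<m. (\<lambda>\<omega>. \<theta>h \<omega> $$ (i, j)) \<in> borel_measurable M) \<and>
     (\<forall>\<omega>\<in>space M. is_arg_min (\<lambda>\<theta>. (frobenius_norm (Y \<omega> - \<theta>))\<^sup>2) (\<lambda>\<theta>. \<theta> \<in> \<Theta>) (\<theta>h \<omega>))"

end

theory Submission
  imports Defs
begin

text \<open>
  The class is covered by finitely many linear subspaces of matrices: for fixed \<open>X\<close> and \<open>Z\<close> the
  matrices \<open>X B Z\<^sup>T\<close> are spanned by the products of the columns of \<open>X\<close> and \<open>Z\<close>. If \<open>V\<close> is a subspace of
  dimension \<open>d\<close>, Gaussian linearization of the square gives \<open>E exp (|P\<^sub>V \<xi>|\<^sup>2 / (4 \<sigma>\<^sup>2)) \<le> 2 powr (d / 2)\<close>,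
  so the largest of the \<open>|P\<^sub>V \<xi>|\<^sup>2\<close> over \<open>N\<close> subspaces has expectation of order \<open>\<sigma>\<^sup>2 (log N + d)\<close>.
  Adding the comparison matrix to every subspace, the basic inequality of least squares and the
  Cauchy-Schwarz inequality yield the oracle inequality with this stochastic term. Counting sparse
  matrices over a finite alphabet bounds \<open>log N\<close>, and replacing \<open>X\<close> or \<open>Z\<close> by the identity where
  that is cheaper produces the minima in the rates.
\<close>

section \<open>Orthonormal systems of functions on a finite set\<close>

text \<open>Matrices enter as functions of the index pair, which turns \<open>dot\<close> into the
  Frobenius inner product. Only values on \<open>I\<close> count, so spans and equalities are tested
  on \<open>I\<close> alone.\<close>

definition dot :: "'i set \<Rightarrow> ('i \<Rightarrow> real) \<Rightarrow> ('i \<Rightarrow> real) \<Rightarrow> real" where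
  "dot I f g = (\<Sum>i\<in>I. f i * g i)"

lemma dot_commute: "dot I f g = dot I g f"
  by (simp add: dot_def mult.commute)

lemma dot_add_left: "dot I (\<lambda>i. f i + g i) h = dot I f h + dot I g h"
  by (simp add: dot_def algebra_simps sum.distrib)

lemma dot_diff_left: "dot I (\<lambda>i. f i - g i) h = dot I f h - dot I g h"
  by (simp add: dot_def algebra_simps sum_subtractf)

lemma dot_scale_left: "dot I (\<lambda>i. c * f i) h = c * dot I f h"
  by (simp add: dot_def algebra_simps sum_distrib_left)

lemma dot_sum_left: "dot I (\<lambda>i. \<Sum>k\<in>K. f k i) h = (\<Sum>k\<in>K. dot I (f k) h)"
  unfolding dot_def by (simp add: sum_distrib_right) (rule sum.swap)

lemma dot_cong: "(\<And>i. i \<in> I \<Longrightarrow> f i = f' i) \<Longrightarrow> (\<And>i. i \<in> I \<Longrightarrow> g i = g' i) \<Longrightarrow> dot I f g = dot I f' g'"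
  unfolding dot_def by (auto intro!: sum.cong)

lemma dot_self_nonneg: "0 \<le> dot I f f"
  by (simp add: dot_def sum_nonneg)

lemma dot_self_eq_0: "finite I \<Longrightarrow> dot I f f = 0 \<longleftrightarrow> (\<forall>i\<in>I. f i = 0)"
  by (simp add: dot_def sum_nonneg_eq_0_iff)

definition orthonormal :: "'i set \<Rightarrow> nat \<Rightarrow> (nat \<Rightarrow> 'i \<Rightarrow> real) \<Rightarrow> bool" where
  "orthonormal I D u \<longleftrightarrow> (\<forall>k<D. \<forall>l<D. dot I (u k) (u l) = (if k = l then 1 else 0))"

definition comb_on :: "'i set \<Rightarrow> nat \<Rightarrow> (nat \<Rightarrow> 'i \<Rightarrow> real) \<Rightarrow> ('i \<Rightarrow> real) \<Rightarrow> bool" where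
  "comb_on I D u f \<longleftrightarrow> (\<exists>c. \<forall>i\<in>I. f i = (\<Sum>k<D. c k * u k i))"

lemma comb_on_scale: "comb_on I D u f \<Longrightarrow> comb_on I D u (\<lambda>i. a * f i)"
  unfolding comb_on_def
proof (elim exE)
  fix c assume "\<forall>i\<in>I. f i = (\<Sum>k<D. c k * u k i)"
  then show "\<exists>c. \<forall>i\<in>I. a * f i = (\<Sum>k<D. c k * u k i)"
    by (intro exI[of _ "\<lambda>k. a * c k"]) (auto simp: sum_distrib_left mult.assoc)
qed

lemma comb_on_add: "comb_on I D u f \<Longrightarrow> comb_on I D u g \<Longrightarrow> comb_on I D u (\<lambda>i. f i + g i)"
  unfolding comb_on_def
proof (elim exE)
  fix c d assume "\<forall>i\<in>I. f i = (\<Sum>k<D. c k * u k i)" "\<forall>i\<in>I. g i = (\<Sum>k<D. d k * u k i)"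
  then show "\<exists>c. \<forall>i\<in>I. f i + g i = (\<Sum>k<D. c k * u k i)"
    by (intro exI[of _ "\<lambda>k. c k + d k"]) (auto simp: sum.distrib algebra_simps)
qed

lemma comb_on_zero: "comb_on I D u (\<lambda>i. 0)"
  unfolding comb_on_def by (intro exI[of _ "\<lambda>k. 0"]) auto

lemma comb_on_sum:
  "finite K \<Longrightarrow> (\<And>k. k \<in> K \<Longrightarrow> comb_on I D u (f k)) \<Longrightarrow> comb_on I D u (\<lambda>i. \<Sum>k\<in>K. f k i)"
  by (induction K rule: finite_induct) (auto intro: comb_on_add comb_on_zero)

lemma comb_on_Suc: "comb_on I D u f \<Longrightarrow> comb_on I (Suc D) (u(D := w)) f"
  unfolding comb_on_def
proof (elim exE)
  fix c assume "\<forall>i\<in>I. f i = (\<Sum>k<D. c k * u k i)"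
  then show "\<exists>c. \<forall>i\<in>I. f i = (\<Sum>k<Suc D. c k * (u(D := w)) k i)"
    by (intro exI[of _ "c(D := 0)"]) auto
qed

text \<open>A vector whose residual vanishes on \<open>I\<close> is skipped, so linear dependence
  only lowers \<open>D\<close>; hence an inequality with \<open>card V\<close>.\<close>

lemma gram_schmidt:
  assumes "finite I" "finite V"
  shows "\<exists>D u. D \<le> card V \<and> orthonormal I D u \<and> (\<forall>v\<in>V. comb_on I D u v)"
  using assms(2)
proof (induction V rule: finite_induct)
  case empty
  then show ?case by (auto simp: orthonormal_def intro!: exI[of _ 0])
next
  case (insert v V)
  then obtain D u where D: "D \<le> card V" and u: "orthonormal I D u" and V: "\<forall>v\<in>V. comb_on I D u v"
    by blast
  define r where "r = (\<lambda>i. v i - (\<Sum>k<D. dot I v (u k) * u k i))"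
  have orth: "dot I r (u l) = 0" if "l < D" for l
  proof -
    have "dot I r (u l) = dot I v (u l) - (\<Sum>k<D. dot I v (u k) * dot I (u k) (u l))"
      unfolding r_def by (simp add: dot_diff_left dot_sum_left dot_scale_left)
    also have "(\<Sum>k<D. dot I v (u k) * dot I (u k) (u l))
        = (\<Sum>k<D. if k = l then dot I v (u l) else 0)"
      using u that by (intro sum.cong) (auto simp: orthonormal_def)
    finally show ?thesis using that by simp
  qed
  show ?case
  proof (cases "dot I r r = 0")
    case True
    then have "\<forall>i\<in>I. v i = (\<Sum>k<D. dot I v (u k) * u k i)"
      using dot_self_eq_0[OF assms(1), of r] by (auto simp: r_def)
    then have "comb_on I D u v"
      unfolding comb_on_def by (intro exI[of _ "\<lambda>k. dot I v (u k)"])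
    with D u V insert.hyps show ?thesis by (intro exI[of _ D] exI[of _ u]) auto
  next
    case False
    define N where "N = sqrt (dot I r r)"
    have N: "N > 0" "N * N = dot I r r"
      using False dot_self_nonneg[of I r] by (auto simp: N_def)
    define w where "w = (\<lambda>i. (1 / N) * r i)"
    have w1: "dot I w w = 1"
      unfolding w_def using N by (simp add: dot_scale_left dot_commute[of I r "\<lambda>i. (1 / N) * r i"] del: times_divide_eq_left)
         (simp add: N(2)[symmetric])
    have w0: "dot I w (u l) = 0" "dot I (u l) w = 0" if "l < D" for l
      unfolding dot_commute[of I "u l"] using orth[OF that] by (simp_all add: w_def dot_scale_left del: times_divide_eq_left)
    have "orthonormal I (Suc D) (u(D := w))"
      using u w0 w1 unfolding orthonormal_def by (auto simp: less_Suc_eq)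
    moreover have "comb_on I (Suc D) (u(D := w)) v"
      unfolding comb_on_def
    proof (intro exI[of _ "\<lambda>k. if k < D then dot I v (u k) else N"] ballI)
      fix i assume "i \<in> I"
      have "v i = (\<Sum>k<D. dot I v (u k) * u k i) + N * w i"
        using N by (simp add: w_def r_def)
      then show "v i = (\<Sum>k<Suc D. (if k < D then dot I v (u k) else N) * (u(D := w)) k i)"
        by simp
    qed
    ultimately show ?thesis
      using D V insert.hyps by (intro exI[of _ "Suc D"] exI[of _ "u(D := w)"]) (auto intro: comb_on_Suc simp del: fun_upd_apply)
  qed
qed

text \<open>The last factor is the squared norm of the projection of \<open>x\<close> onto the span
  of the \<open>u k\<close>. Since \<open>f\<close> lies in that span, only this part of the noise
  is felt, and \<open>D\<close> replaces the ambient dimension.\<close>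

lemma orthonormal_Cauchy_Schwarz:
  assumes u: "orthonormal I D u" and f: "comb_on I D u f"
  shows "(dot I x f)\<^sup>2 \<le> dot I f f * (\<Sum>k<D. (dot I x (u k))\<^sup>2)"
proof -
  obtain c where c: "\<forall>i\<in>I. f i = (\<Sum>k<D. c k * u k i)" using f by (auto simp: comb_on_def)
  have dotf: "dot I f y = (\<Sum>k<D. c k * dot I (u k) y)" for y
  proof -
    have "dot I f y = dot I (\<lambda>i. \<Sum>k<D. c k * u k i) y" using c by (intro dot_cong) auto
    then show ?thesis by (simp add: dot_sum_left dot_scale_left)
  qed
  have "dot I (u k) f = c k" if "k < D" for k
  proof -
    have "dot I (u k) f = (\<Sum>l<D. c l * dot I (u l) (u k))" using dotf by (simp add: dot_commute[of I "u k"])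
    also have "\<dots> = (\<Sum>l<D. if l = k then c k else 0)"
      using u that by (intro sum.cong) (auto simp: orthonormal_def)
    finally show ?thesis using that by simp
  qed
  then have ff: "dot I f f = (\<Sum>k<D. (c k)\<^sup>2)" by (simp add: dotf power2_eq_square)
  have "dot I x f = (\<Sum>k<D. c k * dot I x (u k))" using dotf[of x] by (simp add: dot_commute[of I x])
  then show ?thesis unfolding ff by (simp add: Cauchy_Schwarz_ineq_sum)
qed

section \<open>Projections of sub-Gaussian noise\<close>

lemma nn_integral_normal_density: "\<sigma> > 0 \<Longrightarrow> (\<integral>\<^sup>+x. ennreal (normal_density \<mu> \<sigma> x) \<partial>lborel) = 1"
  by (subst nn_integral_eq_integral) auto

lemma nn_integral_std_normal_exp_linear:
  "(\<integral>\<^sup>+g. ennreal (std_normal_density g * exp (a * g)) \<partial>lborel) = ennreal (exp (a\<^sup>2 / 2))"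
proof -
  \<comment> \<open>Completing the square turns the tilted density into that of a Gaussian with mean
    \<open>a\<close>.\<close>
  have "std_normal_density g * exp (a * g) = exp (a\<^sup>2 / 2) * normal_density a 1 g" for g
    by (simp add: normal_density_def field_simps flip: exp_add)
       (simp add: power2_eq_square field_simps)
  then have "(\<integral>\<^sup>+g. ennreal (std_normal_density g * exp (a * g)) \<partial>lborel)
      = (\<integral>\<^sup>+g. ennreal (exp (a\<^sup>2 / 2)) * ennreal (normal_density a 1 g) \<partial>lborel)"
    by (simp add: ennreal_mult)
  also have "\<dots> = ennreal (exp (a\<^sup>2 / 2))"
    by (subst nn_integral_cmult) (auto simp: nn_integral_normal_density)
  finally show ?thesis .
qed

lemma nn_integral_std_normal_exp_square:
  "(\<integral>\<^sup>+g. ennreal (std_normal_density g * exp (g\<^sup>2 / 4)) \<partial>lborel) = ennreal (sqrt 2)"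
proof -
  have "std_normal_density g * exp (g\<^sup>2 / 4) = sqrt 2 * normal_density 0 (sqrt 2) g" for g
    by (simp add: normal_density_def field_simps real_sqrt_mult flip: exp_add)
  \<comment> \<open>The exponent \<open>- g\<^sup>2 / 2 + g\<^sup>2 / 4\<close> belongs to variance
    2; the factor \<open>sqrt 2\<close> repairs the normalization.\<close>
  then have "(\<integral>\<^sup>+g. ennreal (std_normal_density g * exp (g\<^sup>2 / 4)) \<partial>lborel)
      = (\<integral>\<^sup>+g. ennreal (sqrt 2) * ennreal (normal_density 0 (sqrt 2) g) \<partial>lborel)"
    by (simp add: ennreal_mult)
  also have "\<dots> = ennreal (sqrt 2)"
    by (subst nn_integral_cmult) (auto simp: nn_integral_normal_density)
  finally show ?thesis .
qed

context prob_space
begin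

text \<open>Independence factorizes the exponential moment. With \<open>ennreal\<close> integrals no
  integrability of the product has to be shown, and Tonelli's theorem applies freely below.\<close>

lemma subgaussian_dot:
  assumes I: "finite I" and X: "indep_vars (\<lambda>_. borel) X I"
    and sg: "\<And>i. i \<in> I \<Longrightarrow> sub_gaussian M \<sigma> (X i)"
  shows "(\<integral>\<^sup>+\<omega>. ennreal (exp (dot I (\<lambda>i. X i \<omega>) w)) \<partial>M) \<le> ennreal (exp (\<sigma>\<^sup>2 / 2 * dot I w w))"
proof -
  have "(\<integral>\<^sup>+\<omega>. ennreal (exp (dot I (\<lambda>i. X i \<omega>) w)) \<partial>M)
      = (\<integral>\<^sup>+\<omega>. (\<Prod>i\<in>I. ennreal (exp (w i * X i \<omega>))) \<partial>M)"
    by (simp add: dot_def exp_sum I prod_ennreal mult.commute)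
  also have "\<dots> = (\<Prod>i\<in>I. \<integral>\<^sup>+\<omega>. ennreal (exp (w i * X i \<omega>)) \<partial>M)"
  proof (rule indep_vars_nn_integral[OF I])
    show "indep_vars (\<lambda>_. borel) (\<lambda>i \<omega>. ennreal (exp (w i * X i \<omega>))) I"
      by (rule indep_vars_compose2[OF X]) measurable
  qed auto
  also have "\<dots> \<le> (\<Prod>i\<in>I. ennreal (exp ((w i)\<^sup>2 * \<sigma>\<^sup>2 / 2)))"
  proof (rule prod_mono_ennreal)
    fix i assume "i \<in> I"
    then show "(\<integral>\<^sup>+\<omega>. ennreal (exp (w i * X i \<omega>)) \<partial>M) \<le> ennreal (exp ((w i)\<^sup>2 * \<sigma>\<^sup>2 / 2))"
      using sg[of i] by (subst nn_integral_eq_integral) (auto simp: sub_gaussian_def ennreal_leI)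
  qed
  also have "\<dots> = ennreal (exp (\<sigma>\<^sup>2 / 2 * dot I w w))"
    by (simp add: prod_ennreal dot_def I sum_distrib_left power2_eq_square mult_ac flip: exp_sum)
  finally show ?thesis .
qed

text \<open>
  The extra linear term, orthogonal to the \<open>u k\<close>, makes the induction work: the square of
  \<open>\<langle>X, u D\<rangle>\<close> is linearized by averaging over a standard Gaussian \<open>g\<close>, and the resulting linear term
  \<open>a g \<langle>X, u D\<rangle>\<close> is absorbed into \<open>w\<close>, which stays orthogonal to the remaining vectors.
\<close>

lemma subgaussian_projection_aux:
  assumes I: "finite I" and X: "indep_vars (\<lambda>_. borel) X I"
    and sg: "\<And>i. i \<in> I \<Longrightarrow> sub_gaussian M \<sigma> (X i)" and \<sigma>: "\<sigma> > 0"
    and u: "orthonormal I D u" and w: "\<And>k. k < D \<Longrightarrow> dot I w (u k) = 0"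
  shows "(\<integral>\<^sup>+\<omega>. ennreal (exp (dot I (\<lambda>i. X i \<omega>) w
            + (\<Sum>k<D. (dot I (\<lambda>i. X i \<omega>) (u k))\<^sup>2) / (4 * \<sigma>\<^sup>2))) \<partial>M)
         \<le> ennreal (sqrt 2 ^ D * exp (\<sigma>\<^sup>2 / 2 * dot I w w))"
  using u w
proof (induction D arbitrary: w)
  case 0
  then show ?case using subgaussian_dot[OF I X sg, of w] by simp
next
  case (Suc D)
  have Xm[measurable]: "X i \<in> borel_measurable M" if "i \<in> I" for i
    using X that by (auto simp: indep_vars_def)
  have dm[measurable]: "(\<lambda>\<omega>. dot I (\<lambda>i. X i \<omega>) v) \<in> borel_measurable M" for v
    unfolding dot_def by measurable
  \<comment> \<open>Chosen so that \<open>(a * y \<omega>)\<^sup>2 / 2\<close> is exactly the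
    summand with index \<open>D\<close>.\<close>
  define a where "a = 1 / (sqrt 2 * \<sigma>)"
  define y where "y \<omega> = dot I (\<lambda>i. X i \<omega>) (u D)" for \<omega>
  define q where "q \<omega> = (\<Sum>k<D. (dot I (\<lambda>i. X i \<omega>) (u k))\<^sup>2) / (4 * \<sigma>\<^sup>2)" for \<omega>
  have ym[measurable]: "y \<in> borel_measurable M" and qm[measurable]: "q \<in> borel_measurable M"
    unfolding y_def q_def by measurable
  interpret L: pair_sigma_finite M lborel ..
  have uD: "dot I (u D) (u D) = 1" "k < D \<Longrightarrow> dot I (u D) (u k) = 0" for k
    using Suc.prems(1) by (auto simp: orthonormal_def)
  have wD: "dot I w (u D) = 0" using Suc.prems(2) by simp
  have dot_shift: "dot I (\<lambda>i. X i \<omega>) (\<lambda>i. w i + a * g * u D i) = dot I (\<lambda>i. X i \<omega>) w + a * g * y \<omega>" for g \<omega>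
    by (simp add: dot_commute[of I "\<lambda>i. X i \<omega>"] dot_add_left dot_scale_left y_def mult.assoc)
  have "(\<integral>\<^sup>+\<omega>. ennreal (exp (dot I (\<lambda>i. X i \<omega>) w
            + (\<Sum>k<Suc D. (dot I (\<lambda>i. X i \<omega>) (u k))\<^sup>2) / (4 * \<sigma>\<^sup>2))) \<partial>M)
      = (\<integral>\<^sup>+\<omega>. ennreal (exp (dot I (\<lambda>i. X i \<omega>) w + q \<omega>)) * ennreal (exp ((a * y \<omega>)\<^sup>2 / 2)) \<partial>M)"
  proof (intro nn_integral_cong)
    fix \<omega>
    have "dot I (\<lambda>i. X i \<omega>) w + (\<Sum>k<Suc D. (dot I (\<lambda>i. X i \<omega>) (u k))\<^sup>2) / (4 * \<sigma>\<^sup>2)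
        = (dot I (\<lambda>i. X i \<omega>) w + q \<omega>) + (a * y \<omega>)\<^sup>2 / 2"
      by (simp add: q_def y_def a_def power_mult_distrib power_divide add_divide_distrib)
    then show "ennreal (exp (dot I (\<lambda>i. X i \<omega>) w + (\<Sum>k<Suc D. (dot I (\<lambda>i. X i \<omega>) (u k))\<^sup>2) / (4 * \<sigma>\<^sup>2)))
        = ennreal (exp (dot I (\<lambda>i. X i \<omega>) w + q \<omega>)) * ennreal (exp ((a * y \<omega>)\<^sup>2 / 2))"
      by (simp only: exp_add ennreal_mult exp_ge_zero mult_nonneg_nonneg)
  qed
  \<comment> \<open>The Gaussian moment formula is read backwards: the exponential of a square
    becomes an average of exponentials of linear forms.\<close>
  also have "\<dots> = (\<integral>\<^sup>+\<omega>. ennreal (exp (dot I (\<lambda>i. X i \<omega>) w + q \<omega>)) *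
        (\<integral>\<^sup>+g. ennreal (std_normal_density g * exp (a * y \<omega> * g)) \<partial>lborel) \<partial>M)"
    by (simp only: nn_integral_std_normal_exp_linear)
  also have "\<dots> = (\<integral>\<^sup>+\<omega>. (\<integral>\<^sup>+g. ennreal (std_normal_density g) *
        ennreal (exp (dot I (\<lambda>i. X i \<omega>) (\<lambda>i. w i + a * g * u D i) + q \<omega>)) \<partial>lborel) \<partial>M)"
  proof (intro nn_integral_cong)
    fix \<omega>
    have "ennreal (exp (dot I (\<lambda>i. X i \<omega>) w + q \<omega>)) * ennreal (std_normal_density g * exp (a * y \<omega> * g))
        = ennreal (std_normal_density g) *
          ennreal (exp (dot I (\<lambda>i. X i \<omega>) (\<lambda>i. w i + a * g * u D i) + q \<omega>))" for g
      unfolding dot_shift by (simp add: exp_add mult_ac flip: ennreal_mult)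
    then show "ennreal (exp (dot I (\<lambda>i. X i \<omega>) w + q \<omega>)) *
        (\<integral>\<^sup>+g. ennreal (std_normal_density g * exp (a * y \<omega> * g)) \<partial>lborel)
      = (\<integral>\<^sup>+g. ennreal (std_normal_density g) *
        ennreal (exp (dot I (\<lambda>i. X i \<omega>) (\<lambda>i. w i + a * g * u D i) + q \<omega>)) \<partial>lborel)"
      by (subst nn_integral_cmult[symmetric]) simp_all
  qed
  also have "\<dots> = (\<integral>\<^sup>+g. (\<integral>\<^sup>+\<omega>. ennreal (std_normal_density g) *
        ennreal (exp (dot I (\<lambda>i. X i \<omega>) (\<lambda>i. w i + a * g * u D i) + q \<omega>)) \<partial>M) \<partial>lborel)"
    by (subst L.Fubini') (simp_all add: dot_shift)
  also have "\<dots> = (\<integral>\<^sup>+g. ennreal (std_normal_density g) * (\<integral>\<^sup>+\<omega>.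
        ennreal (exp (dot I (\<lambda>i. X i \<omega>) (\<lambda>i. w i + a * g * u D i) + q \<omega>)) \<partial>M) \<partial>lborel)"
    by (intro nn_integral_cong nn_integral_cmult) (simp add: dot_shift)
  also have "\<dots> \<le> (\<integral>\<^sup>+g. ennreal (std_normal_density g) *
        ennreal (sqrt 2 ^ D * exp (\<sigma>\<^sup>2 / 2 * dot I w w) * exp (g\<^sup>2 / 4)) \<partial>lborel)"
  proof (intro nn_integral_mono mult_left_mono)
    fix g
    let ?w = "\<lambda>i. w i + a * g * u D i"
    have "dot I ?w (u k) = 0" if "k < D" for k
      using Suc.prems(2)[of k] uD(2)[OF that] that by (simp add: dot_add_left dot_scale_left)
    moreover have "orthonormal I D u" using Suc.prems(1) by (auto simp: orthonormal_def)
    \<comment> \<open>By orthogonality the shift adds only \<open>(a * g)\<^sup>2\<close>.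
      Multiplied by \<open>\<sigma>\<^sup>2 / 2\<close> this is \<open>g\<^sup>2 / 4\<close>, which
      the Gaussian weight still integrates.\<close>
    moreover have "dot I ?w ?w = dot I w w + g\<^sup>2 / (2 * \<sigma>\<^sup>2)"
    proof -
      have "dot I ?w ?w = dot I w w + (a * g)\<^sup>2"
        using wD uD(1) by (simp add: dot_add_left dot_scale_left dot_commute[of I _ ?w] dot_commute[of I "u D" w] power2_eq_square)
      then show ?thesis by (simp add: a_def power_mult_distrib power_divide)
    qed
    then have "\<sigma>\<^sup>2 / 2 * dot I ?w ?w = \<sigma>\<^sup>2 / 2 * dot I w w + g\<^sup>2 / 4"
      using \<sigma> by (simp add: field_simps)
    then have "sqrt 2 ^ D * exp (\<sigma>\<^sup>2 / 2 * dot I w w) * exp (g\<^sup>2 / 4)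
        = sqrt 2 ^ D * exp (\<sigma>\<^sup>2 / 2 * dot I ?w ?w)"
      by (simp only: exp_add mult.assoc)
    ultimately show "(\<integral>\<^sup>+\<omega>. ennreal (exp (dot I (\<lambda>i. X i \<omega>) ?w + q \<omega>)) \<partial>M)
        \<le> ennreal (sqrt 2 ^ D * exp (\<sigma>\<^sup>2 / 2 * dot I w w) * exp (g\<^sup>2 / 4))"
      using Suc.IH[of ?w] by (simp only: q_def)
  qed simp
  also have "\<dots> = (\<integral>\<^sup>+g. ennreal (sqrt 2 ^ D * exp (\<sigma>\<^sup>2 / 2 * dot I w w)) *
        ennreal (std_normal_density g * exp (g\<^sup>2 / 4)) \<partial>lborel)"
    by (intro nn_integral_cong) (simp add: mult_ac flip: ennreal_mult)
  \<comment> \<open>Each direction costs one factor \<open>sqrt 2\<close>.\<close>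
  also have "\<dots> = ennreal (sqrt 2 ^ D * exp (\<sigma>\<^sup>2 / 2 * dot I w w)) * ennreal (sqrt 2)"
    by (subst nn_integral_cmult) (simp_all only: nn_integral_std_normal_exp_square, simp)
  also have "\<dots> = ennreal (sqrt 2 ^ Suc D * exp (\<sigma>\<^sup>2 / 2 * dot I w w))"
    by (simp add: mult_ac flip: ennreal_mult)
  finally show ?case .
qed

lemma subgaussian_projection:
  assumes "finite I" "indep_vars (\<lambda>_. borel) X I"
    and "\<And>i. i \<in> I \<Longrightarrow> sub_gaussian M \<sigma> (X i)" "\<sigma> > 0" "orthonormal I D u"
  shows "(\<integral>\<^sup>+\<omega>. ennreal (exp ((\<Sum>k<D. (dot I (\<lambda>i. X i \<omega>) (u k))\<^sup>2) / (4 * \<sigma>\<^sup>2))) \<partial>M)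
         \<le> ennreal (sqrt 2 ^ D)"
  using subgaussian_projection_aux[OF assms, of "\<lambda>_. 0"] by (simp add: dot_def)

end

section \<open>Least squares over a finite union of subspaces\<close>

text \<open>The arithmetic-geometric mean inequality for \<open>N * S = (t * N) * (S / t)\<close>;
  \<open>t\<close> distributes the weight between the two terms.\<close>

lemma two_mult_le_of_square_le:
  fixes d N S t :: real
  assumes "d\<^sup>2 \<le> N * S" "0 \<le> N" "0 \<le> S" "0 < t"
  shows "2 * d \<le> t * N + S / t"
proof (rule power2_le_imp_le)
  define x y where "x = t * N" and "y = S / t"
  have "(2 * d)\<^sup>2 \<le> 4 * (N * S)" using assms(1) by (simp add: power_mult_distrib)
  also have "N * S = x * y" using assms(4) by (simp add: x_def y_def)
  also have "4 * (x * y) \<le> (x + y)\<^sup>2"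
    using sum_squares_bound[of x y] by (simp add: power2_sum)
  finally show "(2 * d)\<^sup>2 \<le> (t * N + S / t)\<^sup>2" by (simp add: x_def y_def)
  show "0 \<le> t * N + S / t" using assms by simp
qed

text \<open>Here \<open>x\<close> is the noise, and \<open>h\<close> and \<open>g\<close> are the
  errors of the estimator and of the comparison matrix. Expanding the squares in \<open>min\<close>
  leaves twice the inner product of \<open>x\<close> with \<open>h - g\<close>, which is split so
  that a small multiple of the error of the estimator can be absorbed on the left.\<close>

lemma least_squares_deterministic:
  assumes min: "dot I (\<lambda>i. x i - h i) (\<lambda>i. x i - h i) \<le> dot I (\<lambda>i. x i - g i) (\<lambda>i. x i - g i)"
    and S: "(dot I x (\<lambda>i. h i - g i))\<^sup>2 \<le> dot I (\<lambda>i. h i - g i) (\<lambda>i. h i - g i) * S" "0 \<le> S"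
    and e: "0 < e" "e \<le> 1"
  shows "dot I h h \<le> (1 + e) * dot I g g + 9 / e * S"
proof -
  define H G N d where "H = dot I h h" and "G = dot I g g"
    and "N = dot I (\<lambda>i. h i - g i) (\<lambda>i. h i - g i)" and "d = dot I x (\<lambda>i. h i - g i)"
  have nonneg: "0 \<le> H" "0 \<le> G" "0 \<le> N" unfolding H_def G_def N_def by (rule dot_self_nonneg)+
  have "H \<le> G + 2 * d"
  proof -
    have "dot I (\<lambda>i. x i - f i) (\<lambda>i. x i - f i) = dot I x x - 2 * dot I x f + dot I f f" for f
      by (simp add: dot_diff_left dot_commute[of I _ "\<lambda>i. x i - f i"] dot_commute[of I f x])
    moreover have "d = dot I x h - dot I x g"
      by (simp add: d_def dot_commute[of I x] dot_diff_left)
    ultimately show ?thesis using min by (simp add: H_def G_def)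
  qed
  \<comment> \<open>The weight \<open>e / 6\<close> becomes \<open>e / 3\<close> through the factor
    2 in the bound for \<open>N\<close>, so \<open>1 - e / 3\<close> remains in front of
    \<open>H\<close>.\<close>
  moreover have "2 * d \<le> e / 6 * N + S / (e / 6)"
    using S e nonneg by (intro two_mult_le_of_square_le) (auto simp: N_def d_def)
  moreover have "e / 6 * N \<le> e / 6 * (2 * H + 2 * G)"
  proof (rule mult_left_mono)
    have "(h i - g i) * (h i - g i) \<le> 2 * (h i * h i) + 2 * (g i * g i)" for i
      using sum_squares_bound[of "h i" "- g i"] by (simp add: algebra_simps power2_eq_square)
    then have "N \<le> (\<Sum>i\<in>I. 2 * (h i * h i) + 2 * (g i * g i))"
      unfolding N_def dot_def by (rule sum_mono)
    also have "\<dots> = 2 * H + 2 * G" by (simp add: H_def G_def dot_def sum.distrib sum_distrib_left)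
    finally show "N \<le> 2 * H + 2 * G" .
  qed (use e in simp)
  ultimately have "(1 - e / 3) * H \<le> (1 + e / 3) * G + 6 / e * S"
    by (simp add: algebra_simps)
  \<comment> \<open>Prepares the division by \<open>1 - e / 3\<close>: the first term needs
    \<open>e * e \<le> e\<close>, the second \<open>1 - e / 3 \<ge> 2 / 3\<close>, which turns 6
    into 9.\<close>
  also have "\<dots> \<le> (1 - e / 3) * ((1 + e) * G) + (1 - e / 3) * (9 / e * S)"
  proof (rule add_mono)
    have "e * e \<le> e * 1" using e by (intro mult_left_mono) auto
    moreover have "(1 - e / 3) * (1 + e) = 1 + 2 / 3 * e - e * e / 3" by (simp add: field_simps)
    ultimately have "1 + e / 3 \<le> (1 - e / 3) * (1 + e)" by simp
    from mult_right_mono[OF this nonneg(2)] show "(1 + e / 3) * G \<le> (1 - e / 3) * ((1 + e) * G)"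
      by (simp only: mult.assoc)
    have "2 / 3 * (9 / e * S) \<le> (1 - e / 3) * (9 / e * S)"
      using e S by (intro mult_right_mono) auto
    then show "6 / e * S \<le> (1 - e / 3) * (9 / e * S)" by simp
  qed
  finally have "(1 - e / 3) * H \<le> (1 - e / 3) * ((1 + e) * G + 9 / e * S)"
    by (simp only: distrib_left)
  then show ?thesis using e by (simp add: H_def G_def)
qed

text \<open>The concave logarithm lies below its tangent at \<open>K\<close>, evaluated at
  \<open>exp s\<close>.\<close>

lemma le_ln_plus_exp: "0 < K \<Longrightarrow> s \<le> ln K - 1 + exp s / K" for s K :: real
  using exp_ge_add_one_self[of "s - ln K"] by (simp add: exp_diff)

text \<open>\<open>G j\<close> spans the subspace with index \<open>j\<close>. The subspace
  containing the estimator depends on the noise, so all projections are controlled at once, at the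
  price \<open>ln (real (card J))\<close>.\<close>

lemma (in prob_space) least_squares_oracle:
  assumes I: "finite I" and X: "indep_vars (\<lambda>_. borel) X I"
    and sg: "\<And>i. i \<in> I \<Longrightarrow> sub_gaussian M \<sigma> (X i)" and \<sigma>: "\<sigma> > 0"
    and J: "finite J" "J \<noteq> {}"
    and G: "\<And>j. j \<in> J \<Longrightarrow> finite (G j) \<and> card (G j) \<le> D"
    and span: "\<And>\<theta>. \<theta> \<in> \<Theta> \<Longrightarrow> \<exists>j\<in>J. \<exists>c. \<forall>i\<in>I. \<theta> i = (\<Sum>v\<in>G j. c v * v i)"
    and meas: "\<And>i. i \<in> I \<Longrightarrow> (\<lambda>\<omega>. th \<omega> i) \<in> borel_measurable M"
    and th: "\<And>\<omega>. \<omega> \<in> space M \<Longrightarrow> th \<omega> \<in> \<Theta>"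
    and min: "\<And>\<omega> \<theta>. \<omega> \<in> space M \<Longrightarrow> \<theta> \<in> \<Theta> \<Longrightarrow>
        (\<Sum>i\<in>I. (\<theta>s i + X i \<omega> - th \<omega> i)\<^sup>2) \<le> (\<Sum>i\<in>I. (\<theta>s i + X i \<omega> - \<theta> i)\<^sup>2)"
    and \<theta>b: "\<theta>b \<in> \<Theta>" and e: "0 < e" "e \<le> 1" and D: "1 \<le> D"
  shows "integrable M (\<lambda>\<omega>. \<Sum>i\<in>I. (th \<omega> i - \<theta>s i)\<^sup>2)" (is "integrable M ?R")
    and "(\<integral>\<omega>. (\<Sum>i\<in>I. (th \<omega> i - \<theta>s i)\<^sup>2) \<partial>M)
      \<le> (1 + e) * (\<Sum>i\<in>I. (\<theta>b i - \<theta>s i)\<^sup>2) + 36 * \<sigma>\<^sup>2 / e * (ln (real (card J)) + real D)"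
proof -
  \<comment> \<open>With \<open>\<theta>b\<close> among the generators, the difference of estimator
    and comparison matrix lies in the span; this costs one dimension.\<close>
  have "\<exists>d u. d \<le> D + 1 \<and> orthonormal I d u \<and> (\<forall>v\<in>insert \<theta>b (G j). comb_on I d u v)"
    if "j \<in> J" for j
  proof -
    have fin: "finite (insert \<theta>b (G j))" and card: "card (insert \<theta>b (G j)) \<le> D + 1"
      using G[OF that] card_insert_le_m1[of "D + 1" "G j" \<theta>b] by auto
    from gram_schmidt[OF I fin] card show ?thesis by (meson le_trans)
  qed
  then have "\<forall>j\<in>J. \<exists>p. fst p \<le> D + 1 \<and> orthonormal I (fst p) (snd p)
      \<and> (\<forall>v\<in>insert \<theta>b (G j). comb_on I (fst p) (snd p) v)" by simp
  then obtain p where p: "\<forall>j\<in>J. fst (p j) \<le> D + 1 \<and> orthonormal I (fst (p j)) (snd (p j))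
      \<and> (\<forall>v\<in>insert \<theta>b (G j). comb_on I (fst (p j)) (snd (p j)) v)"
    by (rule bchoice[THEN exE])
  define d u where "d j = fst (p j)" and "u j = snd (p j)" for j
  have d: "d j \<le> D + 1" and u: "orthonormal I (d j) (u j)"
    and comb_b: "comb_on I (d j) (u j) \<theta>b"
    and comb_G: "v \<in> G j \<Longrightarrow> comb_on I (d j) (u j) v" if "j \<in> J" for j v
    using p that by (auto simp: d_def u_def)
  have Xm[measurable]: "X i \<in> borel_measurable M" if "i \<in> I" for i
    using X that by (auto simp: indep_vars_def)
  define S where "S j \<omega> = (\<Sum>k<d j. (dot I (\<lambda>i. X i \<omega>) (u j k))\<^sup>2)" for j \<omega>
  have S[measurable]: "S j \<in> borel_measurable M" for j unfolding S_def dot_def by measurable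
  have S0: "0 \<le> S j \<omega>" for j \<omega> unfolding S_def by (simp add: sum_nonneg)
  \<comment> \<open>Instead of the maximum of the \<open>S j\<close> and Jensen's inequality, the tangent bound
      \<open>le_ln_plus_exp\<close> is used; its \<open>-1\<close> cancels against \<open>E T / K \<le> 1\<close>.\<close>
  define T where "T \<omega> = (\<Sum>j\<in>J. exp (S j \<omega> / (4 * \<sigma>\<^sup>2)))" for \<omega>
  have T[measurable]: "T \<in> borel_measurable M" unfolding T_def by measurable
  have T0: "0 \<le> T \<omega>" for \<omega> unfolding T_def by (simp add: sum_nonneg)
  \<comment> \<open>The bound for the expectation of \<open>T\<close>: each of its
    \<open>card J\<close> terms contributes at most \<open>sqrt 2 ^ (D + 1)\<close>.\<close>
  define K where "K = real (card J) * sqrt 2 ^ (D + 1)"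
  have K: "0 < K" using J by (simp add: K_def card_gt_0_iff)
  have "(\<integral>\<^sup>+\<omega>. ennreal (T \<omega>) \<partial>M) = (\<Sum>j\<in>J. \<integral>\<^sup>+\<omega>. ennreal (exp (S j \<omega> / (4 * \<sigma>\<^sup>2))) \<partial>M)"
    unfolding T_def by (subst nn_integral_sum[symmetric]) (auto simp: sum_ennreal)
  also have "\<dots> \<le> (\<Sum>j\<in>J. ennreal (sqrt 2 ^ (D + 1)))"
  proof (rule sum_mono)
    fix j assume j: "j \<in> J"
    have "(\<integral>\<^sup>+\<omega>. ennreal (exp (S j \<omega> / (4 * \<sigma>\<^sup>2))) \<partial>M) \<le> ennreal (sqrt 2 ^ d j)"
      unfolding S_def using subgaussian_projection[OF I X sg \<sigma> u[OF j]] by simp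
    also have "\<dots> \<le> ennreal (sqrt 2 ^ (D + 1))"
      using d[OF j] by (intro ennreal_leI power_increasing) auto
    finally show "(\<integral>\<^sup>+\<omega>. ennreal (exp (S j \<omega> / (4 * \<sigma>\<^sup>2))) \<partial>M) \<le> ennreal (sqrt 2 ^ (D + 1))" .
  qed
  also have "\<dots> = ennreal K" by (simp add: K_def ennreal_mult ennreal_of_nat_eq_real_of_nat)
  finally have nnT: "(\<integral>\<^sup>+\<omega>. ennreal (T \<omega>) \<partial>M) \<le> ennreal K" .
  then have intT: "integrable M T"
    using T0 by (intro integrableI_nonneg) (auto intro: le_less_trans)
  have ET: "(\<integral>\<omega>. T \<omega> \<partial>M) \<le> K"
    using nnT T0 K by (subst (asm) nn_integral_eq_integral[OF intT]) (auto simp: ennreal_le_iff)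
  define B where "B = (1 + e) * (\<Sum>i\<in>I. (\<theta>b i - \<theta>s i)\<^sup>2)"
  \<comment> \<open>An integrable majorant of the loss, free of the random index
    \<open>j\<close>.\<close>
  define F where "F \<omega> = B + 9 / e * (4 * \<sigma>\<^sup>2 * (ln K - 1 + T \<omega> / K))" for \<omega>
  have bound: "?R \<omega> \<le> F \<omega>" if \<omega>: "\<omega> \<in> space M" for \<omega>
  proof -
    obtain j c where j: "j \<in> J" and c: "\<forall>i\<in>I. th \<omega> i = (\<Sum>v\<in>G j. c v * v i)"
      using span[OF th[OF \<omega>]] by blast
    have "comb_on I (d j) (u j) (\<lambda>i. \<Sum>v\<in>G j. c v * v i)"
      using G[OF j] comb_G[OF j] by (intro comb_on_sum comb_on_scale) auto
    then have "comb_on I (d j) (u j) (th \<omega>)"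
      using c by (auto simp: comb_on_def)
    then have "comb_on I (d j) (u j) (\<lambda>i. th \<omega> i + (-1) * \<theta>b i)"
      using comb_b[OF j] by (intro comb_on_add comb_on_scale)
    then have comb: "comb_on I (d j) (u j) (\<lambda>i. (th \<omega> i - \<theta>s i) - (\<theta>b i - \<theta>s i))" by simp
    have "dot I (\<lambda>i. th \<omega> i - \<theta>s i) (\<lambda>i. th \<omega> i - \<theta>s i)
        \<le> (1 + e) * dot I (\<lambda>i. \<theta>b i - \<theta>s i) (\<lambda>i. \<theta>b i - \<theta>s i) + 9 / e * S j \<omega>"
    proof (rule least_squares_deterministic[OF _ _ S0 e])
      show "dot I (\<lambda>i. X i \<omega> - (th \<omega> i - \<theta>s i)) (\<lambda>i. X i \<omega> - (th \<omega> i - \<theta>s i))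
        \<le> dot I (\<lambda>i. X i \<omega> - (\<theta>b i - \<theta>s i)) (\<lambda>i. X i \<omega> - (\<theta>b i - \<theta>s i))"
        using min[OF \<omega> \<theta>b] by (simp add: dot_def power2_eq_square algebra_simps)
    qed (use orthonormal_Cauchy_Schwarz[OF u[OF j] comb] in \<open>simp add: S_def\<close>)
    then have "?R \<omega> \<le> B + 9 / e * S j \<omega>" by (simp add: B_def dot_def power2_eq_square)
    also have "S j \<omega> / (4 * \<sigma>\<^sup>2) \<le> ln K - 1 + T \<omega> / K"
    proof -
      \<comment> \<open>The random index is removed by bounding one term by the sum over all of
        \<open>J\<close>.\<close>
      have "exp (S j \<omega> / (4 * \<sigma>\<^sup>2)) \<le> T \<omega>"
        unfolding T_def using J(1) j by (intro member_le_sum) auto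
      then have "exp (S j \<omega> / (4 * \<sigma>\<^sup>2)) / K \<le> T \<omega> / K" using K by (simp add: divide_right_mono)
      with le_ln_plus_exp[OF K, of "S j \<omega> / (4 * \<sigma>\<^sup>2)"] show ?thesis by linarith
    qed
    then have "S j \<omega> \<le> 4 * \<sigma>\<^sup>2 * (ln K - 1 + T \<omega> / K)"
      using \<sigma> by (simp add: pos_divide_le_eq mult.commute)
    then have "9 / e * S j \<omega> \<le> 9 / e * (4 * \<sigma>\<^sup>2 * (ln K - 1 + T \<omega> / K))"
      using e by (intro mult_left_mono) auto
    finally show ?thesis by (simp add: F_def)
  qed
  have intF: "integrable M F" unfolding F_def using intT by (auto intro!: integrable_mult_right)
  have Rm: "?R \<in> borel_measurable M" using meas by measurable
  show intR: "integrable M ?R"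
  proof (rule Bochner_Integration.integrable_bound[OF intF Rm])
    show "AE \<omega> in M. norm (?R \<omega>) \<le> norm (F \<omega>)"
      using bound by (intro AE_I2) (smt (verit) real_norm_def sum_nonneg zero_le_power2)
  qed
  have "(\<integral>\<omega>. ?R \<omega> \<partial>M) \<le> (\<integral>\<omega>. F \<omega> \<partial>M)" using bound by (intro integral_mono intR intF) auto
  also have "\<dots> = B + 9 / e * (4 * \<sigma>\<^sup>2 * (ln K - 1 + (\<integral>\<omega>. T \<omega> \<partial>M) / K))"
    unfolding F_def using intT by (simp add: prob_space)
  also have "\<dots> \<le> B + 9 / e * (4 * \<sigma>\<^sup>2 * ln K)"
    using ET K e \<sigma> by (intro add_left_mono mult_left_mono) (auto simp: field_simps)
  also have "\<dots> = B + 36 * \<sigma>\<^sup>2 / e * ln K" by simp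
  also have "\<dots> \<le> B + 36 * \<sigma>\<^sup>2 / e * (ln (real (card J)) + real D)"
  proof (intro add_left_mono mult_left_mono)
    \<comment> \<open>The extra dimension is absorbed by \<open>ln 2 \<le> 1\<close> and
      \<open>1 \<le> D\<close>.\<close>
    have "ln K = ln (real (card J)) + real (D + 1) * (ln 2 / 2)"
      using J by (simp add: K_def ln_mult_pos ln_realpow ln_sqrt card_gt_0_iff algebra_simps)
    moreover have "real (D + 1) * (ln 2 / 2) \<le> real (D + 1) * (1 / 2)"
      using ln_le_minus_one[of "2::real"] by (intro mult_left_mono) auto
    moreover have "real (D + 1) * (1 / 2) \<le> real D" using D by simp
    ultimately show "ln K \<le> ln (real (card J)) + real D" by linarith
  qed (use e in simp)
  finally show "(\<integral>\<omega>. ?R \<omega> \<partial>M) \<le> (1 + e) * (\<Sum>i\<in>I. (\<theta>b i - \<theta>s i)\<^sup>2)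
      + 36 * \<sigma>\<^sup>2 / e * (ln (real (card J)) + real D)"
    by (simp add: B_def)
qed

section \<open>Entropy of the factor classes\<close>

text \<open>
  A function with at most \<open>N\<close> nonzero values has weight at least \<open>t ^ N\<close> when every nonzero value costs
  a factor \<open>t\<close>, and the total weight of all functions factorizes.
\<close>

lemma card_sparse_functions:
  fixes D :: "real set"
  assumes J: "finite J" and D: "finite D" and t: "0 < t" "t \<le> 1"
  shows "real (card {f \<in> J \<rightarrow>\<^sub>E D. card {j \<in> J. f j \<noteq> 0} \<le> N})
           \<le> (1 / t) ^ N * exp (real (card D) * t * real (card J))"
proof -
  let ?S = "{f \<in> J \<rightarrow>\<^sub>E D. card {j \<in> J. f j \<noteq> 0} \<le> N}"
  define g where "g d = (if d = 0 then 1 else t)" for d :: real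
  have g: "0 \<le> g d" for d using t by (simp add: g_def)
  have fin: "finite (J \<rightarrow>\<^sub>E D)" using J D by (intro finite_PiE) auto
  have "real (card ?S) * t ^ N = (\<Sum>f\<in>?S. t ^ N)" by simp
  also have "\<dots> \<le> (\<Sum>f\<in>?S. \<Prod>j\<in>J. g (f j))"
  proof (rule sum_mono)
    fix f assume f: "f \<in> ?S"
    have "(\<Prod>j\<in>J. g (f j)) = t ^ card {j \<in> J. f j \<noteq> 0}"
      unfolding g_def using J by (subst prod.If_cases) (auto simp: Int_def)
    moreover have "t ^ N \<le> t ^ card {j \<in> J. f j \<noteq> 0}"
      using f t by (intro power_decreasing) auto
    ultimately show "t ^ N \<le> (\<Prod>j\<in>J. g (f j))" by simp
  qed
  also have "\<dots> \<le> (\<Sum>f\<in>J \<rightarrow>\<^sub>E D. \<Prod>j\<in>J. g (f j))"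
    using fin g by (intro sum_mono2) (auto intro: prod_nonneg)
  also have "\<dots> = (\<Prod>j\<in>J. \<Sum>d\<in>D. g d)"
    by (subst prod_sum_PiE[OF J]) (use D in auto)
  also have "\<dots> \<le> (\<Prod>j\<in>J. exp (real (card D) * t))"
  proof (intro prod_mono conjI sum_nonneg g)
    \<comment> \<open>At most one letter is zero and has weight 1; the added \<open>t\<close> covers
      all other letters, whether or not \<open>0\<close> belongs to \<open>D\<close>.\<close>
    have "(\<Sum>d\<in>D. g d) \<le> (\<Sum>d\<in>D. (if d = 0 then 1 else 0) + t)"
      using t by (intro sum_mono) (auto simp: g_def)
    also have "\<dots> \<le> 1 + real (card D) * t"
      using D by (simp add: sum.distrib)
    also have "\<dots> \<le> exp (real (card D) * t)" by (rule exp_ge_add_one_self)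
    finally show "(\<Sum>d\<in>D. g d) \<le> exp (real (card D) * t)" .
  qed
  also have "\<dots> = exp (real (card D) * t * real (card J))"
    by (simp add: mult_ac flip: exp_of_nat_mult)
  finally show ?thesis using t by (simp add: field_simps power_divide)
qed

lemma factor_class_carrier: "(s = 0 \<Longrightarrow> n = k) \<Longrightarrow> factor_class D n k s \<subseteq> carrier_mat n k"
  by (auto simp: factor_class_def)

text \<open>The row constraints are relaxed to a total of at most \<open>n * s\<close> nonzero
  entries, and matrices are identified with functions on index pairs.\<close>

lemma factor_class_finite_card:
  assumes D: "finite D" and s: "0 < s" "s \<le> k"
  shows "finite (factor_class D n k s)"
    and "real (card (factor_class D n k s))
           \<le> (real k / real s) ^ (n * s) * exp (real (card D) * (real n * real s))"
proof -
  let ?J = "{..<n} \<times> {..<k}"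
  let ?S = "{f \<in> ?J \<rightarrow>\<^sub>E D. card {j \<in> ?J. f j \<noteq> 0} \<le> n * s}"
  let ?F = "\<lambda>A. restrict (\<lambda>ij. A $$ ij) ?J"
  have inj: "inj_on ?F (factor_class D n k s)"
  proof (rule inj_onI)
    fix A B assume A: "A \<in> factor_class D n k s" "B \<in> factor_class D n k s" and eq: "?F A = ?F B"
    have "A \<in> carrier_mat n k" "B \<in> carrier_mat n k" using A s by (auto simp: factor_class_def)
    moreover have "A $$ (i, j) = B $$ (i, j)" if "i < n" "j < k" for i j
      using fun_cong[OF eq, of "(i, j)"] that by simp
    ultimately show "A = B" by (intro eq_matI) auto
  qed
  have img: "?F ` factor_class D n k s \<subseteq> ?S"
  proof (rule image_subsetI)
    fix A assume "A \<in> factor_class D n k s"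
    then have A: "A \<in> carrier_mat n k" "elements_mat A \<subseteq> D" "\<And>i. i < n \<Longrightarrow> l0_norm (Matrix.row A i) \<le> s"
      using s by (auto simp: factor_class_def)
    have entries: "A $$ x \<in> D" if "x \<in> ?J" for x
      using A(1,2) that by (fastforce simp: elements_mat_def)
    have "card {j \<in> ?J. ?F A j \<noteq> 0} = card (SIGMA i:{..<n}. {j. j < k \<and> A $$ (i, j) \<noteq> 0})"
      by (intro arg_cong[where f = card]) auto
    also have "\<dots> = (\<Sum>i<n. card {j. j < k \<and> A $$ (i, j) \<noteq> 0})"
      by (intro card_SigmaI) auto
    also have "\<dots> = (\<Sum>i<n. l0_norm (Matrix.row A i))"
      using A(1) by (intro sum.cong) (auto simp: l0_norm_def intro!: arg_cong[where f = card])
    also have "\<dots> \<le> (\<Sum>i<n. s)" using A(3) by (intro sum_mono) auto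
    finally have "card {j \<in> ?J. ?F A j \<noteq> 0} \<le> n * s" by simp
    with entries show "?F A \<in> ?S" by (intro CollectI conjI) (auto simp: PiE_iff)
  qed
  have finS: "finite ?S" using D by (intro finite_subset[OF _ finite_PiE[of ?J "\<lambda>_. D"]]) auto
  show "finite (factor_class D n k s)"
    using finite_imageD[OF finite_subset[OF img finS] inj] .
  have "card (factor_class D n k s) \<le> card ?S"
    using card_image[OF inj] card_mono[OF finS img] by simp
  \<comment> \<open>The weight \<open>t = s / k\<close> balances the two factors: \<open>t\<close>
    times the \<open>n * k\<close> positions gives \<open>n * s\<close>.\<close>
  also have "real (card ?S) \<le> (1 / (real s / real k)) ^ (n * s)
      * exp (real (card D) * (real s / real k) * real (card ?J))"
    using s D by (intro card_sparse_functions) auto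
  also have "\<dots> = (real k / real s) ^ (n * s) * exp (real (card D) * (real n * real s))"
    using s by (simp add: card_cartesian_product)
  finally show "real (card (factor_class D n k s))
           \<le> (real k / real s) ^ (n * s) * exp (real (card D) * (real n * real s))" by simp
qed

text \<open>The logarithm of the counting bound has the terms \<open>n * s * ln (k / s)\<close> and
  \<open>card D * n * s\<close>. Both are dominated because the constant \<open>exp 1\<close> in the
  rate turns \<open>ln (k / s)\<close> into \<open>1 + ln (k / s)\<close>. At \<open>s = 0\<close>
  the class is a singleton and both sides vanish.\<close>

lemma factor_class_entropy:
  assumes D: "finite D" and s: "s \<le> k" and ne: "factor_class D n k s \<noteq> {}"
  shows "finite (factor_class D n k s)"
    and "ln (real (card (factor_class D n k s)))
           \<le> (1 + real (card D)) * (real n * real s * ln (exp 1 * real k / real s))"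
proof -
  show fin: "finite (factor_class D n k s)"
    using factor_class_finite_card(1)[OF D _ s] by (cases "s = 0") (auto simp: factor_class_def)
  show "ln (real (card (factor_class D n k s)))
           \<le> (1 + real (card D)) * (real n * real s * ln (exp 1 * real k / real s))"
  proof (cases "s = 0")
    case True
    then show ?thesis by (simp add: factor_class_def)
  next
    case False
    then have s0: "0 < s" by simp
    have pos: "0 < real (card (factor_class D n k s))" using fin ne by (simp add: card_gt_0_iff)
    have ks: "0 < real k / real s" "0 \<le> ln (real k / real s)" using s s0 by auto
    have "ln (real (card (factor_class D n k s)))
        \<le> ln ((real k / real s) ^ (n * s) * exp (real (card D) * (real n * real s)))"
      using factor_class_finite_card(2)[OF D s0 s] pos ks by (subst ln_le_cancel_iff) (auto intro!: mult_pos_pos)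
    also have "\<dots> = real n * real s * ln (real k / real s) + real (card D) * (real n * real s)"
      using s s0 by (subst ln_mult_pos) (auto simp: ln_realpow)
    also have "\<dots> \<le> (1 + real (card D)) * (real n * real s * (1 + ln (real k / real s)))"
    proof -
      have "0 \<le> real n * real s * 1 + real (card D) * (real n * real s * ln (real k / real s))"
        using ks by (intro add_nonneg_nonneg mult_nonneg_nonneg) auto
      then show ?thesis by (simp add: algebra_simps)
    qed
    also have "1 + ln (real k / real s) = ln (exp 1 * real k / real s)"
      using s s0 ln_mult_pos[of "exp 1" "real k / real s"] by simp
    finally show ?thesis .
  qed
qed

text \<open>This is \<open>1 + ln x \<le> x\<close> at \<open>x = k / s\<close>. It serves to
  compare the inner dimensions in \<open>dense_rates_bound\<close>.\<close>

lemma sparsity_log_le: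
  assumes "s \<le> k"
  shows "real s * ln (exp 1 * real k / real s) \<le> real k"
proof (cases "s = 0")
  case False
  then have "ln (exp 1 * real k / real s) = 1 + ln (real k / real s)"
    using assms ln_mult_pos[of "exp 1" "real k / real s"] by simp
  also have "\<dots> \<le> real k / real s"
    using ln_le_minus_one[of "real k / real s"] False assms by simp
  finally show ?thesis using False by (simp add: field_simps)
qed simp

section \<open>The structured class\<close>

text \<open>For fixed \<open>X\<close> and \<open>Z\<close> the product is linear in
  \<open>B\<close>: its entries combine \<open>p * q\<close> rank-one matrices, built from columns
  of \<open>X\<close> and \<open>Z\<close>, with the entries of \<open>B\<close> as
  coefficients.\<close>

lemma triple_product_index:
  fixes X B Z :: "'a :: comm_semiring_1 mat"
  assumes "X \<in> carrier_mat n p" "B \<in> carrier_mat p q" "Z \<in> carrier_mat m q" "i < n" "j < m"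
  shows "(X * B * transpose_mat Z) $$ (i, j)
      = (\<Sum>ab\<in>{..<p} \<times> {..<q}. B $$ ab * (X $$ (i, fst ab) * Z $$ (j, snd ab)))"
proof -
  have "(X * B * transpose_mat Z) $$ (i, j) = (X * (B * transpose_mat Z)) $$ (i, j)"
    using assms by (simp add: assoc_mult_mat[of X n p B q _ m])
  also have "\<dots> = (\<Sum>a<p. X $$ (i, a) * (\<Sum>b<q. B $$ (a, b) * Z $$ (j, b)))"
    using assms by (simp add: scalar_prod_def lessThan_atLeast0)
  also have "\<dots> = (\<Sum>a<p. \<Sum>b<q. B $$ (a, b) * (X $$ (i, a) * Z $$ (j, b)))"
    by (simp add: sum_distrib_left mult_ac)
  finally show ?thesis by (simp add: sum.cartesian_product split_beta)
qed

text \<open>Different indices may yield the same function; passing to the image as a set, their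
  coefficients are added up.\<close>

lemma sum_over_image_coefficients:
  fixes c :: "'k \<Rightarrow> real" and f :: "'k \<Rightarrow> 'i \<Rightarrow> real"
  assumes "finite K"
  shows "\<exists>c'. \<forall>i. (\<Sum>k\<in>K. c k * f k i) = (\<Sum>v\<in>f ` K. c' v * v i)"
proof (intro exI allI)
  fix i
  have "(\<Sum>k\<in>K. c k * f k i) = (\<Sum>v\<in>f ` K. \<Sum>k\<in>{k \<in> K. f k = v}. c k * f k i)"
    using assms by (rule sum.image_gen)
  also have "\<dots> = (\<Sum>v\<in>f ` K. (\<Sum>k\<in>{k \<in> K. f k = v}. c k) * v i)"
    by (intro sum.cong) (auto simp: sum_distrib_right)
  finally show "(\<Sum>k\<in>K. c k * f k i) = (\<Sum>v\<in>f ` K. (\<Sum>k\<in>{k \<in> K. f k = v}. c k) * v i)" .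
qed

lemma structured_class_carrier:
  assumes "sn = 0 \<longrightarrow> n = kn" "sm = 0 \<longrightarrow> m = km"
  shows "structured_class Dn Dm n m kn km sn sm \<subseteq> carrier_mat n m"
  using assms factor_class_carrier[of sn n kn Dn] factor_class_carrier[of sm m km Dm]
  by (fastforce simp: structured_class_def)

lemma frobenius_norm_squared:
  "A \<in> carrier_mat n m \<Longrightarrow> (frobenius_norm A)\<^sup>2 = (\<Sum>ij\<in>{..<n} \<times> {..<m}. (A $$ ij)\<^sup>2)"
  by (auto simp: frobenius_norm_def sum_nonneg sum.cartesian_product)

text \<open>
  Each factor \<open>X\<close> may be replaced by the identity, \<open>X B\<close> taking over the role of \<open>B\<close>. This trades the
  entropy of the factor class for the larger inner dimension \<open>p = n\<close>.
\<close>

definition admissible_factors :: "real set \<Rightarrow> nat \<Rightarrow> nat \<Rightarrow> nat \<Rightarrow> real mat set \<Rightarrow> nat \<Rightarrow> bool" where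
  "admissible_factors D n k s F p \<longleftrightarrow> F = factor_class D n k s \<and> p = k \<or> F = {1\<^sub>m n} \<and> p = n"

lemma structured_class_cover:
  assumes sn: "sn = 0 \<longrightarrow> n = kn" and sm: "sm = 0 \<longrightarrow> m = km"
    and FX: "admissible_factors Dn n kn sn FX p" and FZ: "admissible_factors Dm m km sm FZ q"
    and \<theta>: "\<theta> \<in> structured_class Dn Dm n m kn km sn sm"
  obtains X B Z where "X \<in> FX" "Z \<in> FZ" "X \<in> carrier_mat n p" "B \<in> carrier_mat p q"
    "Z \<in> carrier_mat m q" "\<theta> = X * B * transpose_mat Z"
proof -
  obtain X B Z where X: "X \<in> factor_class Dn n kn sn" and B: "B \<in> carrier_mat kn km"
    and Z: "Z \<in> factor_class Dm m km sm" and eq: "\<theta> = X * B * transpose_mat Z"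
    using \<theta> by (auto simp: structured_class_def)
  have Xc: "X \<in> carrier_mat n kn" and Zc: "Z \<in> carrier_mat m km"
    using X Z sn sm factor_class_carrier[of sn n kn Dn] factor_class_carrier[of sm m km Dm] by blast+
  have "\<exists>X' B'. X' \<in> FX \<and> X' \<in> carrier_mat n p \<and> B' \<in> carrier_mat p km \<and> X' * B' = X * B"
    using FX unfolding admissible_factors_def
  proof (elim disjE conjE)
    assume "FX = {1\<^sub>m n}" "p = n"
    then show ?thesis using Xc B by (intro exI[of _ "1\<^sub>m n"] exI[of _ "X * B"]) auto
  qed (use X Xc B in blast)
  then obtain X' B' where X': "X' \<in> FX" "X' \<in> carrier_mat n p" and B': "B' \<in> carrier_mat p km"
    and eqX: "X' * B' = X * B" by blast
  \<comment> \<open>The right factor is exchanged after the left one, starting from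
    \<open>B'\<close>, so the four combinations need no separate treatment.\<close>
  have "\<exists>Z' B''. Z' \<in> FZ \<and> Z' \<in> carrier_mat m q \<and> B'' \<in> carrier_mat p q
      \<and> B'' * transpose_mat Z' = B' * transpose_mat Z"
    using FZ unfolding admissible_factors_def
  proof (elim disjE conjE)
    assume "FZ = {1\<^sub>m m}" "q = m"
    then show ?thesis using Zc B' by (intro exI[of _ "1\<^sub>m m"] exI[of _ "B' * transpose_mat Z"]) auto
  qed (use Z Zc B' in blast)
  then obtain Z' B'' where Z': "Z' \<in> FZ" "Z' \<in> carrier_mat m q" and B'': "B'' \<in> carrier_mat p q"
    and eqZ: "B'' * transpose_mat Z' = B' * transpose_mat Z" by blast
  have "\<theta> = X' * (B' * transpose_mat Z)"
    using X' B' Zc by (simp add: eq eqX[symmetric] assoc_mult_mat[of X' n p B' km _ m])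
  also have "\<dots> = X' * B'' * transpose_mat Z'"
    using X' B'' Z' by (simp add: eqZ[symmetric] assoc_mult_mat[of X' n p B'' q _ m])
  finally show ?thesis using that X' B'' Z' by blast
qed

text \<open>Instance of \<open>least_squares_oracle\<close> with one subspace per pair in
  \<open>FX \<times> FZ\<close>, each of dimension at most \<open>p * q\<close>.\<close>

lemma structured_class_oracle:
  assumes dims: "1 \<le> p" "1 \<le> q" and sn: "sn = 0 \<longrightarrow> n = kn" and sm: "sm = 0 \<longrightarrow> m = km"
    and \<sigma>: "\<sigma> > 0" and noise: "noise_matrix M \<sigma> n m \<xi>" and \<theta>s: "\<theta>s \<in> carrier_mat n m"
    and lse: "least_squares_estimator M n m (structured_class Dn Dm n m kn km sn sm) (\<lambda>\<omega>. \<theta>s + \<xi> \<omega>) \<theta>h"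
    and FX: "admissible_factors Dn n kn sn FX p" "finite FX" "FX \<noteq> {}"
    and FZ: "admissible_factors Dm m km sm FZ q" "finite FZ" "FZ \<noteq> {}"
    and \<theta>b: "\<theta>b \<in> structured_class Dn Dm n m kn km sn sm" and e: "0 < e" "e \<le> 1"
  shows "integrable M (\<lambda>\<omega>. (frobenius_norm (\<theta>h \<omega> - \<theta>s))\<^sup>2)" (is ?A)
    and "integral\<^sup>L M (\<lambda>\<omega>. (frobenius_norm (\<theta>h \<omega> - \<theta>s))\<^sup>2)
      \<le> (1 + e) * (frobenius_norm (\<theta>b - \<theta>s))\<^sup>2
         + 36 * \<sigma>\<^sup>2 / e * (ln (real (card FX)) + ln (real (card FZ)) + real p * real q)" (is ?B)
proof -
  let ?\<Theta> = "structured_class Dn Dm n m kn km sn sm" and ?I = "{..<n} \<times> {..<m}"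
  interpret prob_space M using noise by (simp add: noise_matrix_def)
  have carrier: "\<theta> \<in> carrier_mat n m" if "\<theta> \<in> ?\<Theta>" for \<theta>
    using structured_class_carrier[OF sn sm] that by blast
  have \<xi>: "\<xi> \<omega> \<in> carrier_mat n m" if "\<omega> \<in> space M" for \<omega> using noise that by (simp add: noise_matrix_def)
  have th: "\<theta>h \<omega> \<in> ?\<Theta>" and amin: "\<theta> \<in> ?\<Theta> \<Longrightarrow>
      (frobenius_norm (\<theta>s + \<xi> \<omega> - \<theta>h \<omega>))\<^sup>2 \<le> (frobenius_norm (\<theta>s + \<xi> \<omega> - \<theta>))\<^sup>2"
    if "\<omega> \<in> space M" for \<omega> \<theta>
    using lse that by (auto simp: least_squares_estimator_def is_arg_min_linorder)
  have diff: "(frobenius_norm (\<theta> - \<theta>s))\<^sup>2 = (\<Sum>ij\<in>?I. (\<theta> $$ ij - \<theta>s $$ ij)\<^sup>2)" if "\<theta> \<in> ?\<Theta>" for \<theta>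
    using carrier[OF that] \<theta>s by (subst frobenius_norm_squared[of _ n m]) (auto intro!: sum.cong)
  have resid: "(frobenius_norm (\<theta>s + \<xi> \<omega> - \<theta>))\<^sup>2 = (\<Sum>ij\<in>?I. (\<theta>s $$ ij + \<xi> \<omega> $$ ij - \<theta> $$ ij)\<^sup>2)"
    if "\<theta> \<in> ?\<Theta>" "\<omega> \<in> space M" for \<theta> \<omega>
    using carrier[OF that(1)] \<theta>s \<xi>[OF that(2)]
    by (subst frobenius_norm_squared[of _ n m]) (auto intro!: sum.cong)
  \<comment> \<open>The rank-one matrix formed from column \<open>fst ab\<close> of the left factor
    and column \<open>snd ab\<close> of the right factor.\<close>
  define f where "f XZ ab ij = (fst XZ $$ (fst ij, fst ab) * snd XZ $$ (snd ij, snd ab) :: real)"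
    for XZ :: "real mat \<times> real mat" and ab ij :: "nat \<times> nat"
  let ?G = "\<lambda>XZ. f XZ ` ({..<p} \<times> {..<q})"
  have fin: "finite (?G XZ) \<and> card (?G XZ) \<le> p * q" for XZ
    using card_image_le[of "{..<p} \<times> {..<q}" "f XZ"] by (simp add: card_cartesian_product)
  have span: "\<exists>XZ\<in>FX \<times> FZ. \<exists>c. \<forall>ij\<in>?I. \<theta> $$ ij = (\<Sum>v\<in>?G XZ. c v * v ij)" if "\<theta> \<in> ?\<Theta>" for \<theta>
  proof -
    obtain X B Z where XZ: "X \<in> FX" "Z \<in> FZ" and XBZ: "X \<in> carrier_mat n p" "B \<in> carrier_mat p q"
      "Z \<in> carrier_mat m q" and eq: "\<theta> = X * B * transpose_mat Z"
      using structured_class_cover[OF sn sm FX(1) FZ(1) \<open>\<theta> \<in> ?\<Theta>\<close>] .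
    obtain c where c: "\<And>ij. (\<Sum>ab\<in>{..<p} \<times> {..<q}. B $$ ab * f (X, Z) ab ij) = (\<Sum>v\<in>?G (X, Z). c v * v ij)"
      using sum_over_image_coefficients[of "{..<p} \<times> {..<q}" "\<lambda>ab. B $$ ab" "f (X, Z)"] by auto
    have "\<theta> $$ ij = (\<Sum>v\<in>?G (X, Z). c v * v ij)" if mem: "ij \<in> ?I" for ij
    proof -
      obtain i j where ij: "ij = (i, j)" "i < n" "j < m" using mem by auto
      show ?thesis unfolding c[symmetric] ij(1) eq triple_product_index[OF XBZ ij(2,3)] by (simp add: f_def)
    qed
    with XZ show ?thesis by blast
  qed
  let ?\<Theta>' = "(\<lambda>\<theta> ij. \<theta> $$ ij) ` ?\<Theta>"
  have ind: "indep_vars (\<lambda>_. borel) (\<lambda>ij \<omega>. \<xi> \<omega> $$ ij) ?I"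
    and sg: "\<And>ij. ij \<in> ?I \<Longrightarrow> sub_gaussian M \<sigma> (\<lambda>\<omega>. \<xi> \<omega> $$ ij)"
    using noise by (auto simp: noise_matrix_def)
  have span': "\<exists>XZ\<in>FX \<times> FZ. \<exists>c. \<forall>ij\<in>?I. \<theta> ij = (\<Sum>v\<in>?G XZ. c v * v ij)" if "\<theta> \<in> ?\<Theta>'" for \<theta>
    using span that by auto
  have meas: "(\<lambda>\<omega>. \<theta>h \<omega> $$ ij) \<in> borel_measurable M" if "ij \<in> ?I" for ij
    using lse that by (auto simp: least_squares_estimator_def)
  have th': "(\<lambda>ij. \<theta>h \<omega> $$ ij) \<in> ?\<Theta>'" if "\<omega> \<in> space M" for \<omega>
    using th[OF that] by blast
  have min': "(\<Sum>ij\<in>?I. (\<theta>s $$ ij + \<xi> \<omega> $$ ij - \<theta>h \<omega> $$ ij)\<^sup>2)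
      \<le> (\<Sum>ij\<in>?I. (\<theta>s $$ ij + \<xi> \<omega> $$ ij - \<theta> ij)\<^sup>2)" if \<omega>: "\<omega> \<in> space M" and \<theta>: "\<theta> \<in> ?\<Theta>'" for \<omega> \<theta>
  proof -
    obtain \<theta>' where \<theta>': "\<theta>' \<in> ?\<Theta>" and eq: "\<theta> = (\<lambda>ij. \<theta>' $$ ij)" using \<theta> by blast
    show ?thesis using amin[OF \<omega> \<theta>'] unfolding resid[OF th[OF \<omega>] \<omega>] resid[OF \<theta>' \<omega>] eq .
  qed
  have finI: "finite ?I" and finJ: "finite (FX \<times> FZ)" and neJ: "FX \<times> FZ \<noteq> {}" and D: "1 \<le> p * q"
    and \<theta>b': "(\<lambda>ij. \<theta>b $$ ij) \<in> ?\<Theta>'"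
    using FX FZ dims \<theta>b by auto
  note risk = least_squares_oracle[where G = "?G" and \<Theta> = "?\<Theta>'" and \<theta>s = "\<lambda>ij. \<theta>s $$ ij"
      and X = "\<lambda>ij \<omega>. \<xi> \<omega> $$ ij" and th = "\<lambda>\<omega> ij. \<theta>h \<omega> $$ ij",
      OF finI ind sg \<sigma> finJ neJ fin span' meas th' min' \<theta>b' e D]
  have cong: "(frobenius_norm (\<theta>h \<omega> - \<theta>s))\<^sup>2 = (\<Sum>ij\<in>?I. (\<theta>h \<omega> $$ ij - \<theta>s $$ ij)\<^sup>2)" if "\<omega> \<in> space M" for \<omega>
    using diff[OF th[OF that]] .
  show ?A using risk(1) by (subst Bochner_Integration.integrable_cong[OF refl cong])
  have ln: "ln (real (card (FX \<times> FZ))) = ln (real (card FX)) + ln (real (card FZ))"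
    using FX FZ by (simp add: card_cartesian_product ln_mult_pos card_gt_0_iff)
  have "integral\<^sup>L M (\<lambda>\<omega>. (frobenius_norm (\<theta>h \<omega> - \<theta>s))\<^sup>2)
      = (\<integral>\<omega>. (\<Sum>ij\<in>?I. (\<theta>h \<omega> $$ ij - \<theta>s $$ ij)\<^sup>2) \<partial>M)"
    by (rule Bochner_Integration.integral_cong[OF refl cong])
  with risk(2) show ?B unfolding diff[OF \<theta>b] ln of_nat_mult by (simp only:)
qed

section \<open>Choice of factors producing the minima in the rates\<close>

lemma admissible_factors_entropy:
  assumes D: "finite D" and s: "s \<le> k" and ne: "factor_class D n k s \<noteq> {}"
  obtains F where "admissible_factors D n k s F (min n k)" "finite F" "F \<noteq> {}"
    "ln (real (card F)) \<le> (1 + real (card D)) * (real n * real s * ln (exp 1 * real k / real s))"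
proof (cases "k \<le> n")
  \<comment> \<open>The smaller inner dimension is always available: for \<open>k \<le> n\<close> it
    is that of the factor class, otherwise that of the identity, whose entropy is zero.\<close>
  case True
  then show ?thesis
    using that[of "factor_class D n k s"] factor_class_entropy[OF D s ne] ne
    by (simp add: admissible_factors_def min_def)
next
  case False
  have "0 \<le> ln (exp 1 * real k / real s)" if "s \<noteq> 0"
    using s that ln_mult_pos[of "exp 1" "real k / real s"] by simp
  then have "0 \<le> (1 + real (card D)) * (real n * real s * ln (exp 1 * real k / real s))"
    by (cases "s = 0") auto
  with False show ?thesis
    using that[of "{1\<^sub>m n}"] by (simp add: admissible_factors_def min_def)
qed

text \<open>
  If both minima are strictly attained by their first arguments, then \<open>s log (e k / s) \<le> k\<close> excludes
  \<open>r\<^sub>n = k\<^sub>n\<close> and \<open>r\<^sub>m = k\<^sub>m\<close> together, so that the rate already reaches the full dimension \<open>n m\<close>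
  and no separate bound for low-rank matrices is needed.
\<close>

lemma dense_rates_bound:
  fixes n m kn km sn sm :: nat
  assumes n: "1 \<le> n" and m: "1 \<le> m" and sn: "sn \<le> kn" and sm: "sm \<le> km"
    and X: "real n * real (min m km) < real n * real sn * ln (exp 1 * real kn / real sn)"
    and Z: "real m * real (min n kn) < real m * real sm * ln (exp 1 * real km / real sm)"
  shows "real n * real m \<le> real n * real (min m km) + real m * real (min n kn)"
proof -
  have 1: "min m km < kn"
  proof -
    have "real n * real sn * ln (exp 1 * real kn / real sn) \<le> real n * real kn"
      unfolding mult.assoc by (intro mult_left_mono sparsity_log_le sn) simp
    with X have "real n * real (min m km) < real n * real kn" by (rule less_le_trans)
    then show ?thesis using n by simp
  qed
  have 2: "min n kn < km"
  proof -
    have "real m * real sm * ln (exp 1 * real km / real sm) \<le> real m * real km"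
      unfolding mult.assoc by (intro mult_left_mono sparsity_log_le sm) simp
    with Z have "real m * real (min n kn) < real m * real km" by (rule less_le_trans)
    then show ?thesis using m by simp
  qed
  \<comment> \<open>Otherwise both minima are the inner dimensions, giving \<open>km < kn\<close>
    and \<open>kn < km\<close>. Either alternative makes one summand equal to
    \<open>n * m\<close>.\<close>
  from 1 2 have "m \<le> km \<or> n \<le> kn" by linarith
  then show ?thesis by (auto simp: min_def mult.commute)
qed

lemma admissible_factors_rate:
  assumes n: "1 \<le> n" and m: "1 \<le> m" and sn: "sn \<le> kn" and sm: "sm \<le> km"
    and Dn: "finite Dn" and Dm: "finite Dm"
    and neX: "factor_class Dn n kn sn \<noteq> {}" and neZ: "factor_class Dm m km sm \<noteq> {}"
  obtains FX p FZ q where "admissible_factors Dn n kn sn FX p" "finite FX" "FX \<noteq> {}"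
    "admissible_factors Dm m km sm FZ q" "finite FZ" "FZ \<noteq> {}"
    "ln (real (card FX)) + ln (real (card FZ)) + real p * real q
      \<le> (1 + real (card Dn) + real (card Dm)) * (rate_X n m kn km sn + rate_B n m kn km + rate_Z n m kn km sm)"
proof -
  define lx lz where "lx = real n * real sn * ln (exp 1 * real kn / real sn)"
    and "lz = real m * real sm * ln (exp 1 * real km / real sm)"
  define c where "c = 1 + real (card Dn) + real (card Dm)"
  have log0: "0 \<le> real s * ln (exp 1 * real k / real s)" if "s \<le> k" for s k :: nat
    using that ln_mult_pos[of "exp 1" "real k / real s"] by (cases "s = 0") auto
  have l0: "0 \<le> lx" "0 \<le> lz"
    unfolding lx_def lz_def mult.assoc using log0[OF sn] log0[OF sm] by (auto intro!: mult_nonneg_nonneg)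
  obtain FX where FX: "admissible_factors Dn n kn sn FX (min n kn)" "finite FX" "FX \<noteq> {}"
    and "ln (real (card FX)) \<le> (1 + real (card Dn)) * lx"
    using admissible_factors_entropy[OF Dn sn neX] unfolding lx_def .
  moreover have "(1 + real (card Dn)) * lx \<le> c * lx"
    using l0 by (intro mult_right_mono) (auto simp: c_def)
  ultimately have cX: "ln (real (card FX)) \<le> c * lx" by linarith
  obtain FZ where FZ: "admissible_factors Dm m km sm FZ (min m km)" "finite FZ" "FZ \<noteq> {}"
    and "ln (real (card FZ)) \<le> (1 + real (card Dm)) * lz"
    using admissible_factors_entropy[OF Dm sm neZ] unfolding lz_def .
  moreover have "(1 + real (card Dm)) * lz \<le> c * lz"
    using l0 by (intro mult_right_mono) (auto simp: c_def)
  ultimately have cZ: "ln (real (card FZ)) \<le> c * lz" by linarith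
  have IX: "admissible_factors Dn n kn sn {1\<^sub>m n} n" and IZ: "admissible_factors Dm m km sm {1\<^sub>m m} m"
    by (auto simp: admissible_factors_def)
  define RX RB RZ where "RX = rate_X n m kn km sn" and "RB = rate_B n m kn km" and "RZ = rate_Z n m kn km sm"
  have R: "RX = min (real n * real (min m km)) lx" "RB = real (min n kn) * real (min m km)"
    "RZ = min (real m * real (min n kn)) lz"
    by (simp_all add: RX_def RB_def RZ_def rate_X_def rate_B_def rate_Z_def lx_def lz_def)
  have R0: "0 \<le> RX" "0 \<le> RB" "0 \<le> RZ" using l0 by (auto simp: R)
  \<comment> \<open>As \<open>c\<close> is at least 1, it also covers \<open>p * q\<close>, which
    enters with coefficient 1.\<close>
  have c: "x \<le> c * x" if "0 \<le> x" for x
    using mult_right_mono[of 1 c x] that by (simp add: c_def)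
  have cR: "c * (RX + RB + RZ) = c * RX + c * RB + c * RZ" by (simp add: algebra_simps)
  note cs = c[OF R0(1)] c[OF R0(2)] c[OF R0(3)] R0
  note result = that[folded c_def RX_def RB_def RZ_def]
  have card1: "ln (real (card {A})) = 0" for A :: "real mat" by simp
  \<comment> \<open>The cases record which argument attains each minimum. The identity replaces a
    factor whose entropy bound is too large, and \<open>p * q\<close> is then \<open>RB\<close>,
    \<open>RX\<close>, \<open>RZ\<close> or \<open>n * m\<close>, in this order.\<close>
  consider "lx \<le> real n * real (min m km)" "lz \<le> real m * real (min n kn)"
    | "real n * real (min m km) < lx" "lz \<le> real m * real (min n kn)"
    | "lx \<le> real n * real (min m km)" "real m * real (min n kn) < lz"
    | "real n * real (min m km) < lx" "real m * real (min n kn) < lz" by linarith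
  then show ?thesis
  proof cases
    case 1
    then have "RX = lx" "RZ = lz" by (simp_all add: R)
    with cX cZ have "ln (real (card FX)) \<le> c * RX" "ln (real (card FZ)) \<le> c * RZ" by simp_all
    then have "ln (real (card FX)) + ln (real (card FZ)) + RB \<le> c * (RX + RB + RZ)"
      using cs unfolding cR by linarith
    then show ?thesis by (rule result[OF FX FZ, folded R(2)])
  next
    case 2
    then have RX: "RX = real n * real (min m km)" and "RZ = lz" by (simp_all add: R)
    with cZ have "ln (real (card FZ)) \<le> c * RZ" by simp
    then have "ln (real (card {1\<^sub>m n :: real mat})) + ln (real (card FZ)) + RX \<le> c * (RX + RB + RZ)"
      using cs card1[of "1\<^sub>m n"] unfolding cR by linarith
    then have "ln (real (card {1\<^sub>m n :: real mat})) + ln (real (card FZ)) + real n * real (min m km)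
        \<le> c * (RX + RB + RZ)" by (simp only: RX)
    then show ?thesis by (rule result[OF IX _ _ FZ, rotated 2]) auto
  next
    case 3
    then have "RX = lx" and RZ: "RZ = real (min n kn) * real m" by (simp_all add: R mult.commute)
    with cX have "ln (real (card FX)) \<le> c * RX" by simp
    then have "ln (real (card FX)) + ln (real (card {1\<^sub>m m :: real mat})) + RZ \<le> c * (RX + RB + RZ)"
      using cs card1[of "1\<^sub>m m"] unfolding cR by linarith
    then have "ln (real (card FX)) + ln (real (card {1\<^sub>m m :: real mat})) + real (min n kn) * real m
        \<le> c * (RX + RB + RZ)" by (simp only: RZ)
    then show ?thesis by (rule result[OF FX IZ, rotated 2]) auto
  next
    case 4
    then have "RX = real n * real (min m km)" "RZ = real m * real (min n kn)" by (simp_all add: R)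
    then have "real n * real m \<le> RX + RZ"
      using dense_rates_bound[OF n m sn sm 4[unfolded lx_def lz_def]] by simp
    then have "ln (real (card {1\<^sub>m n :: real mat})) + ln (real (card {1\<^sub>m m :: real mat})) + real n * real m
        \<le> c * (RX + RB + RZ)"
      using cs card1[of "1\<^sub>m n"] card1[of "1\<^sub>m m"] unfolding cR by linarith
    then show ?thesis by (rule result[OF IX _ _ IZ, rotated 4]) auto
  qed
qed

section \<open>The oracle inequality for the structured class\<close>

lemma factors_pos: "admissible_factors D n k s F p \<Longrightarrow> 1 \<le> n \<Longrightarrow> 1 \<le> k \<Longrightarrow> 1 \<le> p"
  by (auto simp: admissible_factors_def)

text \<open>The cardinalities are fixed before \<open>C\<close>, and everything else is quantified
  after it. The noise term is divided by \<open>min \<epsilon> 1\<close>: for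
  \<open>\<theta>s\<close> in the class the infimum is zero, and division by
  \<open>\<epsilon>\<close> would force zero risk as \<open>\<epsilon>\<close> grows. Integrability
  is asserted because a non-integrable loss would have Bochner integral zero.\<close>

theorem theorem1:
  fixes cn cm :: nat
  shows "\<exists>C>0.
    \<forall>(n::nat) (m::nat) (kn::nat) (km::nat) (sn::nat) (sm::nat) (Dn::real set) (Dm::real set)
      (\<sigma>::real) (M::'a measure) (\<xi>::'a \<Rightarrow> real mat) (\<theta>s::real mat) (\<theta>h::'a \<Rightarrow> real mat) (\<epsilon>::real).
      n \<ge> 1 \<and> m \<ge> 1 \<and> kn \<ge> 1 \<and> km \<ge> 1 \<and> sn \<le> kn \<and> sm \<le> km \<and>
      (sn = 0 \<longrightarrow> n = kn) \<and> (sm = 0 \<longrightarrow> m = km) \<and>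
      finite Dn \<and> card Dn = cn \<and> finite Dm \<and> card Dm = cm \<and>
      \<sigma> > 0 \<and> noise_matrix M \<sigma> n m \<xi> \<and>
      \<theta>s \<in> carrier_mat n m \<and>
      least_squares_estimator M n m (structured_class Dn Dm n m kn km sn sm) (\<lambda>\<omega>. \<theta>s + \<xi> \<omega>) \<theta>h \<and>
      \<epsilon> > 0
      \<longrightarrow>
      integrable M (\<lambda>\<omega>. (frobenius_norm (\<theta>h \<omega> - \<theta>s))\<^sup>2) \<and>
      integral\<^sup>L M (\<lambda>\<omega>. (frobenius_norm (\<theta>h \<omega> - \<theta>s))\<^sup>2)
        \<le> (1 + \<epsilon>) * (INF \<theta>b\<in>structured_class Dn Dm n m kn km sn sm. (frobenius_norm (\<theta>b - \<theta>s))\<^sup>2)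
           + C * \<sigma>\<^sup>2 / min \<epsilon> 1 * (rate_X n m kn km sn + rate_B n m kn km + rate_Z n m kn km sm)"
\<comment> \<open>The 36 comes from \<open>structured_class_oracle\<close>, the other factor from
  \<open>admissible_factors_rate\<close>.\<close>
proof (intro exI[of _ "36 * (1 + real cn + real cm)"] conjI allI impI)
  show "0 < 36 * (1 + real cn + real cm)" by simp
next
  fix n m kn km sn sm :: nat and Dn Dm :: "real set" and \<sigma> :: real and M :: "'a measure"
    and \<xi> :: "'a \<Rightarrow> real mat" and \<theta>s :: "real mat" and \<theta>h :: "'a \<Rightarrow> real mat" and \<epsilon> :: real
  let ?\<Theta> = "structured_class Dn Dm n m kn km sn sm"
  let ?L = "\<lambda>\<omega>. (frobenius_norm (\<theta>h \<omega> - \<theta>s))\<^sup>2"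
  let ?R = "rate_X n m kn km sn + rate_B n m kn km + rate_Z n m kn km sm"
  let ?C = "36 * (1 + real cn + real cm)"
  assume A: "n \<ge> 1 \<and> m \<ge> 1 \<and> kn \<ge> 1 \<and> km \<ge> 1 \<and> sn \<le> kn \<and> sm \<le> km \<and>
      (sn = 0 \<longrightarrow> n = kn) \<and> (sm = 0 \<longrightarrow> m = km) \<and>
      finite Dn \<and> card Dn = cn \<and> finite Dm \<and> card Dm = cm \<and>
      \<sigma> > 0 \<and> noise_matrix M \<sigma> n m \<xi> \<and>
      \<theta>s \<in> carrier_mat n m \<and>
      least_squares_estimator M n m ?\<Theta> (\<lambda>\<omega>. \<theta>s + \<xi> \<omega>) \<theta>h \<and>
      \<epsilon> > 0"
  then have dims: "1 \<le> n" "1 \<le> m" "1 \<le> kn" "1 \<le> km" and s: "sn \<le> kn" "sm \<le> km"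
    and s0: "sn = 0 \<longrightarrow> n = kn" "sm = 0 \<longrightarrow> m = km" and D: "finite Dn" "finite Dm"
    and card: "card Dn = cn" "card Dm = cm" and \<sigma>: "\<sigma> > 0" and noise: "noise_matrix M \<sigma> n m \<xi>"
    and \<theta>s: "\<theta>s \<in> carrier_mat n m"
    and lse: "least_squares_estimator M n m ?\<Theta> (\<lambda>\<omega>. \<theta>s + \<xi> \<omega>) \<theta>h" and \<epsilon>: "\<epsilon> > 0" by blast+
  define e where "e = min \<epsilon> 1"
  have e: "0 < e" "e \<le> 1" "e \<le> \<epsilon>" using \<epsilon> by (auto simp: e_def)
  interpret prob_space M using noise by (simp add: noise_matrix_def)
  \<comment> \<open>A probability space has a point, and the value of the estimator there shows that
    the class and both factor classes are nonempty.\<close>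
  obtain \<omega> where "\<omega> \<in> space M" using not_empty by blast
  then have \<theta>h: "\<theta>h \<omega> \<in> ?\<Theta>" using lse by (auto simp: least_squares_estimator_def is_arg_min_def)
  then have ne: "factor_class Dn n kn sn \<noteq> {}" "factor_class Dm m km sm \<noteq> {}"
    by (auto simp: structured_class_def)
  obtain FX p FZ q where FX: "admissible_factors Dn n kn sn FX p" "finite FX" "FX \<noteq> {}"
    and FZ: "admissible_factors Dm m km sm FZ q" "finite FZ" "FZ \<noteq> {}"
    and rate: "ln (real (card FX)) + ln (real (card FZ)) + real p * real q \<le> (1 + real cn + real cm) * ?R"
    using admissible_factors_rate[OF dims(1,2) s D ne] unfolding card .
  note risk = structured_class_oracle[OF factors_pos[OF FX(1) dims(1,3)] factors_pos[OF FZ(1) dims(2,4)]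
      s0 \<sigma> noise \<theta>s lse FX FZ _ e(1,2)]
  show "integrable M ?L" using risk(1)[OF \<theta>h] .
  \<comment> \<open>The inequality is solved for the comparison error, so that a bound for each
    \<open>\<theta>b\<close> passes to the infimum.\<close>
  have "(integral\<^sup>L M ?L - ?C * \<sigma>\<^sup>2 / e * ?R) / (1 + \<epsilon>)
      \<le> (INF \<theta>b\<in>?\<Theta>. (frobenius_norm (\<theta>b - \<theta>s))\<^sup>2)"
  proof (rule cINF_greatest)
    show "?\<Theta> \<noteq> {}" using \<theta>h by blast
    fix \<theta>b assume \<theta>b: "\<theta>b \<in> ?\<Theta>"
    have "(1 + e) * (frobenius_norm (\<theta>b - \<theta>s))\<^sup>2 \<le> (1 + \<epsilon>) * (frobenius_norm (\<theta>b - \<theta>s))\<^sup>2"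
      using e by (intro mult_right_mono) auto
    moreover have "36 * \<sigma>\<^sup>2 / e * (ln (real (card FX)) + ln (real (card FZ)) + real p * real q)
        \<le> 36 * \<sigma>\<^sup>2 / e * ((1 + real cn + real cm) * ?R)"
      using e by (intro mult_left_mono[OF rate]) auto
    moreover have "36 * \<sigma>\<^sup>2 / e * ((1 + real cn + real cm) * ?R) = ?C * \<sigma>\<^sup>2 / e * ?R" by simp
    ultimately have "integral\<^sup>L M ?L - ?C * \<sigma>\<^sup>2 / e * ?R \<le> (1 + \<epsilon>) * (frobenius_norm (\<theta>b - \<theta>s))\<^sup>2"
      using risk(2)[OF \<theta>b] by linarith
    then show "(integral\<^sup>L M ?L - ?C * \<sigma>\<^sup>2 / e * ?R) / (1 + \<epsilon>) \<le> (frobenius_norm (\<theta>b - \<theta>s))\<^sup>2"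
      using \<epsilon> by (simp add: pos_divide_le_eq mult.commute)
  qed
  then have "integral\<^sup>L M ?L - ?C * \<sigma>\<^sup>2 / e * ?R
      \<le> (1 + \<epsilon>) * (INF \<theta>b\<in>?\<Theta>. (frobenius_norm (\<theta>b - \<theta>s))\<^sup>2)"
    using \<epsilon> by (simp add: pos_divide_le_eq mult.commute)
  then show "integral\<^sup>L M ?L \<le> (1 + \<epsilon>) * (INF \<theta>b\<in>?\<Theta>. (frobenius_norm (\<theta>b - \<theta>s))\<^sup>2)
      + ?C * \<sigma>\<^sup>2 / min \<epsilon> 1 * ?R"
    unfolding e_def by linarith
qed

end
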